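(* Let $u_h$, together with real numbers $\kappa_{0,h}|_{I_n},\kappa_{1,h}|_{I_n},\dots,\kappa_{d+1,h}|_{I_n}$ for $n=1,\dots,N$, be a solution of the space-time finite element scheme (A1)--(A5) described in the context (applied successively for $n=1,\dots,N$, starting from a given $u_h^0\in S_h$), and let $u_h^n=u_h(t_n)\in S_h$, $n=1,\dots,N$, be the numerical solutions it determines. Then for every $n=1,\dots,N$, $$M[u_h(t_n)]=M[u_h(t_{n-1})],\qquad P[u_h(t_n)]=P[u_h(t_{n-1})],\qquad E[u_h(t_n)]=E[u_h(t_{n-1})],$$ where $M$, $P$ and $E$ are the mass, momentum ($\mathbb{R}^d$-valued) and energy functionals defined in the context.
   Context: Setting. Let $d\geqslant 1$ and let $\Omega\subset\mathbb{R}^d$ be a (bounded) rectangular domain with periodic boundary conditions; $\mathrm{i}=\sqrt{-1}$. Let $F:\mathbb{R}^+\to\mathbb{R}$ be a potential function with derivative $f=F':\mathbb{R}^+\to\mathbb{R}$, where $\mathbb{R}^+=[0,\infty)$ (one-sided derivative at $0$). The scheme approximates the nonlinear Schrödinger equation $\mathrm{i}\partial_t u+\Delta u+f(|u|^2)u=0$ in $\Omega\times(0,T]$, $u|_{t=0}=u_0$, with periodic boundary conditions, $T>0$. Functionals. For a complex-valued function $u$ on $\Omega$, $$M[u]=\tfrac12\int_\Omega |u|^2\,\mathrm{d}x,\qquad E[u]=\tfrac12\int_\Omega\bigl(|\nabla u|^2-F(|u|^2)\bigr)\,\mathrm{d}x,\qquad P[u]=\tfrac12\,\mathrm{Im}\int_\Omega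 \bar u\,\nabla u\,\mathrm{d}x\in\mathbb{R}^d .$$ Discrete spaces. $\mathcal{T}_h$ is a shape-regular, quasiuniform triangulation of $\Omega$ with mesh size $h\in(0,1]$. For an integer $r\geqslant 1$, $\mathbb{Q}^r(K)$ is the space of complex-valued polynomials of degree up to $r$ on $K$, and $S_h$ is the periodic complex-valued Lagrange finite element space: the functions $v\in C(\overline\Omega)$ that are periodic (values match on opposite faces of $\Omega$) and satisfy $v|_K\in\mathbb{Q}^r(K)$ for all $K\in\mathcal{T}_h$. Let $N\geqslant 1$, $\tau=T/N$, $t_n=n\tau$, $I_n=[t_{n-1},t_n]$. For an integer $k\geqslant 1$, $\mathbb{P}^k$ is the space of real polynomials of degree at most $k$ in $t$, and $\mathbb{P}^k\otimes S_h=\{\sum_{j=0}^k t^j\phi_j:\phi_j\in S_h\}$ (similarly $\mathbb{P}^{k-1}\otimes S_h$). Scheme. For $n=1,\dots,N$ and given $u_h^{n-1}\in S_h$, find $u_h|_{I_n}\in\mathbb{P}^k\otimes S_h$ and real constants $\kappa_{0,h},\kappa_{1,h},\dots,\kappa_{d+1,h}$ (depending on $n$) such that: (A1) $\displaystyle \mathrm{Re}\int_{t_{n-1}}^{t_n}\int_\Omega \mathrm{i}\partial_t u_h\cdot \mathrm{i}\bar u_h\,\mathrm{d}x\,\mathrm{d}t=0$; (A2) $\displaystyle \mathrm{Re}\int_{t_{n-1}}^{t_n}\int_\Omega \mathrm{i}\nabla\partial_t u_h\cdot \mathrm{i}\nabla\bar u_h\,\mathrm{d}x\,\mathrm{d}t-\mathrm{Re}\int_{t_{n-1}}^{t_n}\int_\Omega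 \mathrm{i}\partial_t u_h\cdot \mathrm{i}f(|u_h|^2)\bar u_h\,\mathrm{d}x\,\mathrm{d}t=0$; (A3) $\displaystyle \mathrm{Re}\int_{t_{n-1}}^{t_n}\int_\Omega \mathrm{i}\partial_t u_h\cdot\partial_j\bar u_h\,\mathrm{d}x\,\mathrm{d}t=0$ for $j=1,\dots,d$; (A4) for all $v_h\in\mathbb{P}^{k-1}\otimes S_h$, $$\begin{aligned}&\mathrm{Re}\int_{t_{n-1}}^{t_n}\int_\Omega \mathrm{i}\partial_t u_h\,\bar v_h\,\mathrm{d}x\,\mathrm{d}t-\mathrm{Re}\int_{t_{n-1}}^{t_n}\int_\Omega\nabla u_h\cdot\nabla\bar v_h\,\mathrm{d}x\,\mathrm{d}t+\mathrm{Re}\int_{t_{n-1}}^{t_n}\int_\Omega f(|u_h|^2)u_h\bar v_h\,\mathrm{d}x\,\mathrm{d}t\\ &=\kappa_{0,h}\,\mathrm{Re}\int_{t_{n-1}}^{t_n}\int_\Omega \mathrm{i}u_h\bar v_h\,\mathrm{d}x\,\mathrm{d}t+\kappa_{1,h}\,\mathrm{Re}\int_{t_{n-1}}^{t_n}\int_\Omega \mathrm{i}\nabla u_h\cdot\nabla\bar v_h\,\mathrm{d}x\,\mathrm{d}t\\ &\quad-\kappa_{1,h}\,\mathrm{Re}\int_{t_{n-1}}^{t_n}\int_\Omega \mathrm{i}f(|u_h|^2)u_h\bar v_h\,\mathrm{d}x\,\mathrm{d}t+\sum_{j=1}^d\kappa_{j+1,h}\,\mathrm{Re}\int_{t_{n-1}}^{t_n}\int_\Omega\partial_j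 u_h\,\bar v_h\,\mathrm{d}x\,\mathrm{d}t;\end{aligned}$$ (A5) $u_h(t_{n-1})=u_h^{n-1}$. Then set $u_h^n:=u_h(t_n)$ and proceed to the next interval. The starting value $u_h^0\in S_h$ is given (for instance the Lagrange interpolant of $u_0$ in $S_h$). In all products above, $\cdot$ is the bilinear (non-conjugating) product; spatial derivatives of finite element functions are taken elementwise. Being a solution of the scheme includes that all integrals occurring in it are well defined (integrable integrands). *)

theory Defs
  imports "HOL-Analysis.Analysis"
begin

text \<open>
  The space dimension is $d = $ \<open>CARD('d)\<close>, with $d \ge 1$ because types are inhabited. The
  rectangular domain is $\Omega = $ \<open>box a b\<close>, its closure is \<open>cbox a b\<close>. Functions on the closure
  of $\Omega$ are total functions whose values outside \<open>cbox a b\<close> play no role.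
\<close>

subsection \<open>Meshes\<close>

definition inradius :: "'a::euclidean_space set \<Rightarrow> real" where
  "inradius K = Sup {\<rho>. 0 \<le> \<rho> \<and> (\<exists>x. cball x \<rho> \<subseteq> K)}"

text \<open>
  \<open>h\<close> is the mesh size, \<open>\<sigma>\<close> the shape-regularity constant and \<open>\<gamma>\<close> the quasiuniformity constant.
  The library's \<^const>\<open>triangulation\<close> says that two elements meet in a common (possibly empty) face.
\<close>

definition regular_mesh ::
  "real^'d \<Rightarrow> real^'d \<Rightarrow> real \<Rightarrow> real \<Rightarrow> real \<Rightarrow> (real^'d) set set \<Rightarrow> bool" where
  "regular_mesh a b h \<sigma> \<gamma> \<T> \<longleftrightarrow>
     triangulation \<T> \<and>
     (\<forall>K\<in>\<T>. int CARD('d) simplex K) \<and>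
     \<Union>\<T> = cbox a b \<and>
     h = Max (diameter ` \<T>) \<and>
     (\<forall>K\<in>\<T>. diameter K \<le> \<sigma> * inradius K) \<and>
     (\<forall>K\<in>\<T>. h \<le> \<gamma> * diameter K)"

subsection \<open>Discrete spaces\<close>

text \<open>Total degree at most \<open>r\<close>, the convention for simplices. The set of multi-indices is finite.\<close>

definition is_poly_on :: "nat \<Rightarrow> (real^'d) set \<Rightarrow> (real^'d \<Rightarrow> complex) \<Rightarrow> bool" where
  "is_poly_on r K v \<longleftrightarrow>
     (\<exists>c :: ('d \<Rightarrow> nat) \<Rightarrow> complex. \<forall>x\<in>K.
        v x = (\<Sum>\<alpha> | sum \<alpha> UNIV \<le> r. c \<alpha> * of_real (\<Prod>i\<in>UNIV. (x $ i) ^ \<alpha> i)))"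

definition periodic_on_box :: "real^'d \<Rightarrow> real^'d \<Rightarrow> (real^'d \<Rightarrow> complex) \<Rightarrow> bool" where
  "periodic_on_box a b v \<longleftrightarrow>
     (\<forall>j. \<forall>x\<in>cbox a b. x $ j = a $ j \<longrightarrow> v (x + (b $ j - a $ j) *\<^sub>R axis j 1) = v x)"

definition fe_space ::
  "real^'d \<Rightarrow> real^'d \<Rightarrow> (real^'d) set set \<Rightarrow> nat \<Rightarrow> (real^'d \<Rightarrow> complex) set" where
  "fe_space a b \<T> r =
     {v. continuous_on (cbox a b) v \<and> periodic_on_box a b v \<and> (\<forall>K\<in>\<T>. is_poly_on r K v)}"

text \<open>The tensor product of the real polynomials in time of degree at most \<open>m\<close> with a space \<open>S\<close>.\<close>

definition poly_tensor ::
  "nat \<Rightarrow> (real^'d \<Rightarrow> complex) set \<Rightarrow> (real \<Rightarrow> real^'d \<Rightarrow> complex) set" where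
  "poly_tensor m S =
     {v. \<exists>\<phi>. (\<forall>j\<le>m. \<phi> j \<in> S) \<and> v = (\<lambda>t x. \<Sum>j\<le>m. of_real (t ^ j) * \<phi> j x)}"

subsection \<open>Derivatives\<close>

text \<open>
  Elementwise spatial derivatives are set to \<open>0\<close> off the union of the interiors of the elements,
  hence inside $\Omega$ only on a null set. This convention keeps all integrands Borel measurable
  up to the behaviour of \<open>f\<close>.
\<close>

definition pderiv_h :: "(real^'d) set set \<Rightarrow> 'd \<Rightarrow> (real^'d \<Rightarrow> complex) \<Rightarrow> real^'d \<Rightarrow> complex" where
  "pderiv_h \<T> j v x =
     (if \<exists>K\<in>\<T>. x \<in> interior K
      then vector_derivative (\<lambda>s. v (x + s *\<^sub>R axis j 1)) (at 0) else 0)"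

definition grad_h :: "(real^'d) set set \<Rightarrow> (real^'d \<Rightarrow> complex) \<Rightarrow> real^'d \<Rightarrow> complex^'d" where
  "grad_h \<T> v x = (\<chi> j. pderiv_h \<T> j v x)"

text \<open>
  The time derivative is taken within the slab \<open>{t0..t1}\<close>: across the time nodes the discrete
  solution is only continuous.
\<close>

definition dt :: "real \<Rightarrow> real \<Rightarrow> (real \<Rightarrow> real^'d \<Rightarrow> complex) \<Rightarrow> real \<Rightarrow> real^'d \<Rightarrow> complex" where
  "dt t0 t1 u t x = vector_derivative (\<lambda>s. u s x) (at t within {t0..t1})"

text \<open>The bilinear product on complex vectors: no conjugation, unlike an inner product.\<close>

definition bdot :: "complex^'d \<Rightarrow> complex^'d \<Rightarrow> complex" where
  "bdot v w = (\<Sum>j\<in>UNIV. v $ j * w $ j)"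

subsection \<open>Functionals\<close>

definition mass :: "real^'d \<Rightarrow> real^'d \<Rightarrow> (real^'d \<Rightarrow> complex) \<Rightarrow> real" where
  "mass a b v = 1/2 * (LINT x:box a b|lborel. (cmod (v x))\<^sup>2)"

definition energy ::
  "real^'d \<Rightarrow> real^'d \<Rightarrow> (real^'d) set set \<Rightarrow> (real \<Rightarrow> real) \<Rightarrow> (real^'d \<Rightarrow> complex) \<Rightarrow> real" where
  "energy a b \<T> F v =
     1/2 * (LINT x:box a b|lborel. (norm (grad_h \<T> v x))\<^sup>2 - F ((cmod (v x))\<^sup>2))"

definition momentum ::
  "real^'d \<Rightarrow> real^'d \<Rightarrow> (real^'d) set set \<Rightarrow> (real^'d \<Rightarrow> complex) \<Rightarrow> real^'d" where
  "momentum a b \<T> v =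
     (\<chi> j. 1/2 * Im (LINT x:box a b|lborel. cnj (v x) * pderiv_h \<T> j v x))"

subsection \<open>Space-time integrals\<close>

definition st_integrable ::
  "real^'d \<Rightarrow> real^'d \<Rightarrow> real \<Rightarrow> real \<Rightarrow> (real \<Rightarrow> real^'d \<Rightarrow> complex) \<Rightarrow> bool" where
  "st_integrable a b t0 t1 g = set_integrable lborel ({t0..t1} \<times> box a b) (\<lambda>(t, x). g t x)"

definition st_integral ::
  "real^'d \<Rightarrow> real^'d \<Rightarrow> real \<Rightarrow> real \<Rightarrow> (real \<Rightarrow> real^'d \<Rightarrow> complex) \<Rightarrow> complex" where
  "st_integral a b t0 t1 g = (LINT t:{t0..t1}|lborel. (LINT x:box a b|lborel. g t x))"

subsection \<open>The scheme\<close>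

text \<open>
  The equations on one time slab \<open>{t0..t1}\<close>. Each of them includes the integrability of its
  integrands on the slab times $\Omega$. The multiplier $\kappa_{j+1,h}$, $j = 1,\dots,d$, is the
  component \<open>\<kappa> $ j\<close>.
\<close>

definition eq_mass ::
  "real^'d \<Rightarrow> real^'d \<Rightarrow> real \<Rightarrow> real \<Rightarrow> (real \<Rightarrow> real^'d \<Rightarrow> complex) \<Rightarrow> bool" where
  "eq_mass a b t0 t1 u \<longleftrightarrow>
     (let g = (\<lambda>t x. (\<i> * dt t0 t1 u t x) * (\<i> * cnj (u t x)))
      in st_integrable a b t0 t1 g \<and> Re (st_integral a b t0 t1 g) = 0)"

definition eq_energy ::
  "real^'d \<Rightarrow> real^'d \<Rightarrow> (real^'d) set set \<Rightarrow> (real \<Rightarrow> real) \<Rightarrow> real \<Rightarrow> real \<Rightarrow>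
    (real \<Rightarrow> real^'d \<Rightarrow> complex) \<Rightarrow> bool" where
  "eq_energy a b \<T> f t0 t1 u \<longleftrightarrow>
     (let g1 = (\<lambda>t x. bdot (\<i> *s grad_h \<T> (\<lambda>y. dt t0 t1 u t y) x)
                            (\<i> *s grad_h \<T> (\<lambda>y. cnj (u t y)) x));
          g2 = (\<lambda>t x. (\<i> * dt t0 t1 u t x) *
                       (\<i> * of_real (f ((cmod (u t x))\<^sup>2)) * cnj (u t x)))
      in st_integrable a b t0 t1 g1 \<and> st_integrable a b t0 t1 g2 \<and>
         Re (st_integral a b t0 t1 g1) - Re (st_integral a b t0 t1 g2) = 0)"

definition eq_momentum ::
  "real^'d \<Rightarrow> real^'d \<Rightarrow> (real^'d) set set \<Rightarrow> real \<Rightarrow> real \<Rightarrow>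
    (real \<Rightarrow> real^'d \<Rightarrow> complex) \<Rightarrow> bool" where
  "eq_momentum a b \<T> t0 t1 u \<longleftrightarrow>
     (\<forall>j. let g = (\<lambda>t x. (\<i> * dt t0 t1 u t x) * pderiv_h \<T> j (\<lambda>y. cnj (u t y)) x)
          in st_integrable a b t0 t1 g \<and> Re (st_integral a b t0 t1 g) = 0)"

definition eq_galerkin ::
  "real^'d \<Rightarrow> real^'d \<Rightarrow> (real^'d) set set \<Rightarrow> nat \<Rightarrow> nat \<Rightarrow> (real \<Rightarrow> real) \<Rightarrow> real \<Rightarrow> real \<Rightarrow>
    (real \<Rightarrow> real^'d \<Rightarrow> complex) \<Rightarrow> real \<Rightarrow> real \<Rightarrow> real^'d \<Rightarrow> bool" where
  "eq_galerkin a b \<T> r k f t0 t1 u \<kappa>0 \<kappa>1 \<kappa> \<longleftrightarrow>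
     (\<forall>v \<in> poly_tensor (k - 1) (fe_space a b \<T> r).
        let g1 = (\<lambda>t x. \<i> * dt t0 t1 u t x * cnj (v t x));
            g2 = (\<lambda>t x. bdot (grad_h \<T> (u t) x) (grad_h \<T> (\<lambda>y. cnj (v t y)) x));
            g3 = (\<lambda>t x. of_real (f ((cmod (u t x))\<^sup>2)) * u t x * cnj (v t x));
            g4 = (\<lambda>t x. \<i> * u t x * cnj (v t x));
            g5 = (\<lambda>t x. bdot (\<i> *s grad_h \<T> (u t) x) (grad_h \<T> (\<lambda>y. cnj (v t y)) x));
            g6 = (\<lambda>t x. \<i> * of_real (f ((cmod (u t x))\<^sup>2)) * u t x * cnj (v t x));
            g7 = (\<lambda>j t x. pderiv_h \<T> j (u t) x * cnj (v t x));
            R = (\<lambda>g. Re (st_integral a b t0 t1 g))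
        in (\<forall>g \<in> {g1, g2, g3, g4, g5, g6} \<union> range g7. st_integrable a b t0 t1 g) \<and>
           R g1 - R g2 + R g3 = \<kappa>0 * R g4 + \<kappa>1 * R g5 - \<kappa>1 * R g6 + (\<Sum>j\<in>UNIV. \<kappa> $ j * R (g7 j)))"

text \<open>One step of the scheme on \<open>{t0..t1}\<close>, from the initial value \<open>U\<close>.\<close>

definition scheme_step ::
  "real^'d \<Rightarrow> real^'d \<Rightarrow> (real^'d) set set \<Rightarrow> nat \<Rightarrow> nat \<Rightarrow> (real \<Rightarrow> real) \<Rightarrow> real \<Rightarrow> real \<Rightarrow>
    (real^'d \<Rightarrow> complex) \<Rightarrow> (real \<Rightarrow> real^'d \<Rightarrow> complex) \<Rightarrow> real \<Rightarrow> real \<Rightarrow> real^'d \<Rightarrow> bool" where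
  "scheme_step a b \<T> r k f t0 t1 U u \<kappa>0 \<kappa>1 \<kappa> \<longleftrightarrow>
     (\<exists>w \<in> poly_tensor k (fe_space a b \<T> r). \<forall>t\<in>{t0..t1}. \<forall>x\<in>cbox a b. u t x = w t x) \<and>
     eq_mass a b t0 t1 u \<and>
     eq_energy a b \<T> f t0 t1 u \<and>
     eq_momentum a b \<T> t0 t1 u \<and>
     eq_galerkin a b \<T> r k f t0 t1 u \<kappa>0 \<kappa>1 \<kappa> \<and>
     (\<forall>x\<in>cbox a b. u t0 x = U x)"

definition tnode :: "real \<Rightarrow> nat \<Rightarrow> nat \<Rightarrow> real" where
  "tnode T N n = real n * (T / real N)"

text \<open>
  \<open>u\<close> is the space-time discrete solution on \<open>{0..T}\<close> and \<open>uh n\<close> its nodal values, with \<open>uh 0\<close>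
  the given starting value.
\<close>

definition scheme_solution ::
  "real^'d \<Rightarrow> real^'d \<Rightarrow> (real^'d) set set \<Rightarrow> nat \<Rightarrow> nat \<Rightarrow> (real \<Rightarrow> real) \<Rightarrow> real \<Rightarrow> nat \<Rightarrow>
    (nat \<Rightarrow> real^'d \<Rightarrow> complex) \<Rightarrow> (real \<Rightarrow> real^'d \<Rightarrow> complex) \<Rightarrow>
    (nat \<Rightarrow> real) \<Rightarrow> (nat \<Rightarrow> real) \<Rightarrow> (nat \<Rightarrow> real^'d) \<Rightarrow> bool" where
  "scheme_solution a b \<T> r k f T N uh u \<kappa>0 \<kappa>1 \<kappa> \<longleftrightarrow>
     uh 0 \<in> fe_space a b \<T> r \<and>
     (\<forall>n\<in>{1..N}.
        scheme_step a b \<T> r k f (tnode T N (n - 1)) (tnode T N n) (uh (n - 1)) u (\<kappa>0 n) (\<kappa>1 n) (\<kappa> n) \<and>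
        (\<forall>x\<in>cbox a b. uh n x = u (tnode T N n) x))"

end

theory Submission
  imports Defs
begin

text \<open>
  Three equations of the scheme are the conservation laws in disguise: on each time slab, the left-hand
  side of the mass, energy or momentum equation equals, up to a constant factor, the increment of the corresponding functional between the two time nodes. Since the equation says
  that this left-hand side vanishes, the functional is conserved.

  For mass and energy only calculus in time is needed. The integrands are integrable on the
  slab, so the order of integration may be exchanged (\<open>Re_st_integral_eq\<close>). For fixed \<open>x\<close> the real part
  of the integrand is the time derivative of $-\frac12|u|^2$, of
  $-\frac12|\nabla u|^2$ or of $-\frac12F(|u|^2)$, and the
  fundamental theorem of calculus applies (\<open>has_integral_potential\<close>). The spatial derivatives
  commute with the time derivative because $u$ is a polynomial in time whose coefficients are
  finite element functions. The derivative $f$ of $F$ may be discontinuous, which is why the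
  gauge integral enters.

  For the momentum there is a spatial ingredient. Here
  $\partial_t(\bar u\,\partial_ju)$ has the imaginary part
  $2\,\mathrm{Im}(\partial_t\bar u\,\partial_ju)+\mathrm{Im}\,\partial_j(\bar u\,\partial_tu)$.
  The first term is twice the real part of the integrand in the momentum equation. The second is the
  imaginary part of the elementwise derivative of a continuous,
  periodic, piecewise smooth function, and the integral of such a derivative over the box is $0$
  (\<open>integral_pderiv_h_eq_0\<close>): the integral of a periodic function is invariant under cyclic shifts of
  the box, so the difference quotients integrate to $0$, and they converge boundedly almost
  everywhere to the derivative.
\<close>

section \<open>Functions with a continuous directional derivative\<close>

text \<open>
  Only derivatives in one fixed axis direction are ever taken, so a class of functions that are
  \<open>C\<^sup>1\<close> along that direction replaces total differentiability. The restrictions of finite element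
  functions to an element extend to such functions on the whole space; working with the
  extensions avoids one-sided derivatives at element boundaries.
\<close>

definition axis_deriv ::
  "'d::finite \<Rightarrow> (real^'d \<Rightarrow> complex) \<Rightarrow> (real^'d \<Rightarrow> complex) \<Rightarrow> bool" where
  "axis_deriv j p q \<longleftrightarrow>
     continuous_on UNIV q \<and>
     (\<forall>x s. ((\<lambda>s. p (x + s *\<^sub>R axis j 1)) has_vector_derivative q (x + s *\<^sub>R axis j 1)) (at s))"

text \<open>
  Continuity of the function itself, in all directions, makes the derivative of a product continuous.
\<close>

definition C1_along :: "'d::finite \<Rightarrow> (real^'d \<Rightarrow> complex) \<Rightarrow> bool" where
  "C1_along j p \<longleftrightarrow> continuous_on UNIV p \<and> (\<exists>q. axis_deriv j p q)"

lemma C1_along_const: "C1_along j (\<lambda>x. c)"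
  unfolding C1_along_def axis_deriv_def
  by (auto intro!: exI[of _ "\<lambda>x. 0"] continuous_intros)

lemma C1_along_coordinate: "C1_along j (\<lambda>x. of_real (x $ i))"
  unfolding C1_along_def axis_deriv_def
proof (intro conjI exI[of _ "\<lambda>x. of_real (axis j 1 $ i)"] allI)
  fix x s
  show "((\<lambda>s. complex_of_real ((x + s *\<^sub>R axis j 1) $ i)) has_vector_derivative
      of_real (axis j 1 $ i)) (at s)"
    by (auto intro!: derivative_eq_intros)
qed (auto intro!: continuous_intros)

lemma C1_along_add:
  assumes "C1_along j p" "C1_along j q"
  shows "C1_along j (\<lambda>x. p x + q x)"
proof -
  obtain p' q' where "axis_deriv j p p'" "axis_deriv j q q'"
    using assms by (auto simp: C1_along_def)
  then have "axis_deriv j (\<lambda>x. p x + q x) (\<lambda>x. p' x + q' x)"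
    by (auto simp: axis_deriv_def intro!: continuous_intros has_vector_derivative_add)
  then show ?thesis using assms by (auto simp: C1_along_def intro!: continuous_intros)
qed

lemma C1_along_mult:
  assumes "C1_along j p" "C1_along j q"
  shows "C1_along j (\<lambda>x. p x * q x)"
proof -
  obtain p' q' where "axis_deriv j p p'" "axis_deriv j q q'"
    using assms by (auto simp: C1_along_def)
  then have "axis_deriv j (\<lambda>x. p x * q x) (\<lambda>x. p x * q' x + p' x * q x)"
    using assms
    by (auto simp: axis_deriv_def C1_along_def intro!: continuous_intros has_vector_derivative_mult)
  then show ?thesis using assms by (auto simp: C1_along_def intro!: continuous_intros)
qed

lemma C1_along_cnj:
  assumes "C1_along j p"
  shows "C1_along j (\<lambda>x. cnj (p x))"
proof -
  obtain p' where "axis_deriv j p p'"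
    using assms by (auto simp: C1_along_def)
  then have "axis_deriv j (\<lambda>x. cnj (p x)) (\<lambda>x. cnj (p' x))"
    by (auto simp: axis_deriv_def intro!: continuous_intros has_vector_derivative_cnj)
  then show ?thesis using assms by (auto simp: C1_along_def intro!: continuous_intros)
qed

lemma C1_along_sum:
  assumes "\<And>i. i \<in> I \<Longrightarrow> C1_along j (p i)"
  shows "C1_along j (\<lambda>x. \<Sum>i\<in>I. p i x)"
  using assms
  by (induction I rule: infinite_finite_induct) (auto intro: C1_along_const C1_along_add)

lemma C1_along_prod:
  assumes "\<And>i. i \<in> I \<Longrightarrow> C1_along j (p i)"
  shows "C1_along j (\<lambda>x. \<Prod>i\<in>I. p i x)"
  using assms
  by (induction I rule: infinite_finite_induct) (auto intro: C1_along_const C1_along_mult)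

lemma C1_along_power:
  assumes "C1_along j p"
  shows "C1_along j (\<lambda>x. p x ^ n)"
  using assms by (induction n) (auto intro: C1_along_const C1_along_mult)

lemma C1_along_polynomial:
  "C1_along j (\<lambda>x. \<Sum>\<alpha>\<in>A. c \<alpha> * of_real (\<Prod>i\<in>I. (x $ i) ^ \<alpha> i))"
  unfolding of_real_prod of_real_power
  by (intro C1_along_sum C1_along_mult C1_along_const C1_along_prod C1_along_power
      C1_along_coordinate)

lemma axis_deriv_lipschitz:
  assumes "axis_deriv j p q" "0 \<le> M"
    and "\<And>s. s \<in> {\<alpha>..\<beta>} \<Longrightarrow> norm (q (x + s *\<^sub>R axis j 1)) \<le> M"
  shows "M-lipschitz_on {\<alpha>..\<beta>} (\<lambda>s. p (x + s *\<^sub>R axis j 1))"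
proof (rule bounded_derivative_imp_lipschitz)
  show "((\<lambda>s. p (x + s *\<^sub>R axis j 1)) has_derivative
      (\<lambda>h. h *\<^sub>R q (x + s *\<^sub>R axis j 1))) (at s within {\<alpha>..\<beta>})" if "s \<in> {\<alpha>..\<beta>}" for s
    using assms(1) that
    by (auto simp: axis_deriv_def has_vector_derivative_def intro: has_derivative_at_withinI)
  show "onorm (\<lambda>h. h *\<^sub>R q (x + s *\<^sub>R axis j 1)) \<le> M" if "s \<in> {\<alpha>..\<beta>}" for s
    using assms(3)[OF that] assms(2)
    by (intro onorm_bound) (auto simp: mult.commute[of M] intro: mult_left_mono)
qed (use assms in auto)

section \<open>Partitions of a box and elementwise derivatives\<close>

text \<open>
  This class contains the finite element functions and, unlike a space of piecewise polynomials
  of bounded degree, is closed under products.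
\<close>

definition piecewise_C1 ::
  "(real^'d::finite) set set \<Rightarrow> 'd \<Rightarrow> (real^'d \<Rightarrow> complex) \<Rightarrow> bool" where
  "piecewise_C1 \<T> j v \<longleftrightarrow> (\<forall>K\<in>\<T>. \<exists>p. C1_along j p \<and> (\<forall>x\<in>K. v x = p x))"

lemma is_poly_imp_piecewise_C1:
  assumes "\<And>K. K \<in> \<T> \<Longrightarrow> is_poly_on r K v"
  shows "piecewise_C1 \<T> j v"
  unfolding piecewise_C1_def
proof
  fix K assume "K \<in> \<T>"
  then obtain c where
    "\<forall>x\<in>K. v x = (\<Sum>\<alpha> | sum \<alpha> UNIV \<le> r. c \<alpha> * of_real (\<Prod>i\<in>UNIV. (x $ i) ^ \<alpha> i))"
    using assms by (auto simp: is_poly_on_def)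
  then show "\<exists>p. C1_along j p \<and> (\<forall>x\<in>K. v x = p x)"
    using C1_along_polynomial by (intro exI conjI) auto
qed

lemma piecewise_C1_const: "piecewise_C1 \<T> j (\<lambda>x. c)"
  unfolding piecewise_C1_def using C1_along_const by blast

lemma piecewise_C1_mult:
  assumes "piecewise_C1 \<T> j v" "piecewise_C1 \<T> j w"
  shows "piecewise_C1 \<T> j (\<lambda>x. v x * w x)"
  unfolding piecewise_C1_def
proof
  fix K assume "K \<in> \<T>"
  then obtain p q where "C1_along j p" "\<forall>x\<in>K. v x = p x" "C1_along j q" "\<forall>x\<in>K. w x = q x"
    using assms unfolding piecewise_C1_def by meson
  then show "\<exists>p. C1_along j p \<and> (\<forall>x\<in>K. v x * w x = p x)"
    by (intro exI[of _ "\<lambda>x. p x * q x"]) (auto intro: C1_along_mult)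
qed

lemma piecewise_C1_cnj:
  assumes "piecewise_C1 \<T> j v"
  shows "piecewise_C1 \<T> j (\<lambda>x. cnj (v x))"
  unfolding piecewise_C1_def
proof
  fix K assume "K \<in> \<T>"
  then obtain p where "C1_along j p" "\<forall>x\<in>K. v x = p x"
    using assms unfolding piecewise_C1_def by meson
  then show "\<exists>p. C1_along j p \<and> (\<forall>x\<in>K. cnj (v x) = p x)"
    by (intro exI[of _ "\<lambda>x. cnj (p x)"]) (auto intro: C1_along_cnj)
qed

lemma piecewise_C1_sum:
  assumes "\<And>i. i \<in> I \<Longrightarrow> piecewise_C1 \<T> j (v i)"
  shows "piecewise_C1 \<T> j (\<lambda>x. \<Sum>i\<in>I. v i x)"
  unfolding piecewise_C1_def
proof
  fix K assume "K \<in> \<T>"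
  then have "\<forall>i\<in>I. \<exists>p. C1_along j p \<and> (\<forall>x\<in>K. v i x = p x)"
    using assms unfolding piecewise_C1_def by meson
  then obtain p where "\<And>i. i \<in> I \<Longrightarrow> C1_along j (p i) \<and> (\<forall>x\<in>K. v i x = p i x)"
    by metis
  then show "\<exists>p. C1_along j p \<and> (\<forall>x\<in>K. (\<Sum>i\<in>I. v i x) = p x)"
    by (intro exI[of _ "\<lambda>x. \<Sum>i\<in>I. p i x"]) (auto intro: C1_along_sum)
qed

lemma AE_coordinate_neq: "AE x in lborel. (x::real^'d) $ j \<noteq> c"
proof -
  have "negligible {x::real^'d. x \<bullet> axis j 1 = c}"
    by (intro negligible_standard_hyperplane) (simp add: axis_in_Basis_iff)
  then have "negligible {x::real^'d. x $ j = c}"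
    by (simp add: inner_axis)
  then have "{x::real^'d. x $ j = c} \<in> null_sets lborel"
    by (auto simp: negligible_iff_null_sets null_sets_completion_iff)
  then show ?thesis
    by (auto dest: AE_not_in)
qed

lemma set_integrable_bounded_box:
  fixes g :: "real^'d \<Rightarrow> 'b::euclidean_space"
  assumes "g \<in> borel_measurable borel" "\<And>x. x \<in> box a b \<Longrightarrow> norm (g x) \<le> B"
  shows "set_integrable lborel (box a b) g"
  unfolding set_integrable_def
  using assms by (intro integrableI_bounded_set_indicator[where B = B]) (auto simp: emeasure_lborel_box_eq)

lemma set_integrable_continuous_box:
  fixes g :: "real^'d \<Rightarrow> 'b::euclidean_space"
  assumes "continuous_on (cbox a b) g"
  shows "set_integrable lborel (box a b) g"
proof (rule set_integrable_subset)
  show "set_integrable lborel (cbox a b) g"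
    using borel_integrable_compact[OF compact_cbox assms]
    by (simp add: set_integrable_def indicator_scaleR_eq_if)
qed (use box_subset_cbox in auto)

text \<open>
  What integration by parts needs from a mesh: its elements cover the box, and their boundaries
  are null sets, so that elementwise derivatives are defined almost everywhere.
\<close>

locale box_partition =
  fixes a b :: "real^'d" and \<T> :: "(real^'d) set set"
  assumes side_pos: "\<And>j. a $ j < b $ j"
    and finite_mesh: "finite \<T>"
    and closed_element: "\<And>K. K \<in> \<T> \<Longrightarrow> closed K"
    and negligible_frontier: "\<And>K. K \<in> \<T> \<Longrightarrow> negligible (frontier K)"
    and Union_mesh: "\<Union>\<T> = cbox a b"
begin

definition mesh_interior :: "(real^'d) set" where
  "mesh_interior = (\<Union>K\<in>\<T>. interior K)"

lemma open_mesh_interior: "open mesh_interior"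
  by (auto simp: mesh_interior_def)

lemma mesh_interior_subset: "mesh_interior \<subseteq> cbox a b"
  using interior_subset Union_mesh by (fastforce simp: mesh_interior_def)

lemma AE_mesh_interior: "AE x in lborel. x \<in> box a b \<longrightarrow> x \<in> mesh_interior"
proof -
  have "negligible (\<Union>(frontier ` \<T>))"
    using finite_mesh negligible_frontier by (intro negligible_Union) auto
  moreover have "\<Union>(frontier ` \<T>) \<in> sets lborel"
    using finite_mesh by (auto intro!: sets.finite_UN)
  ultimately have "\<Union>(frontier ` \<T>) \<in> null_sets lborel"
    by (auto simp: negligible_iff_null_sets null_sets_completion_iff)
  then have "AE x in lborel. x \<notin> \<Union>(frontier ` \<T>)"
    by (rule AE_not_in)
  then show ?thesis
  proof (rule eventually_mono)
    fix x assume x: "x \<notin> \<Union>(frontier ` \<T>)"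
    show "x \<in> box a b \<longrightarrow> x \<in> mesh_interior"
    proof
      assume "x \<in> box a b"
      then obtain K where K: "K \<in> \<T>" "x \<in> K"
        using Union_mesh box_subset_cbox by blast
      then have "x \<in> interior K"
        using x closed_element[OF K(1)] by (auto simp: frontier_def)
      with K show "x \<in> mesh_interior" by (auto simp: mesh_interior_def)
    qed
  qed
qed

lemma pderiv_h_off: "x \<notin> mesh_interior \<Longrightarrow> pderiv_h \<T> j v x = 0"
  by (auto simp: pderiv_h_def mesh_interior_def)

lemma pderiv_h_eqI:
  assumes "x \<in> mesh_interior"
    and "((\<lambda>s. v (x + s *\<^sub>R axis j 1)) has_vector_derivative d) (at 0)"
  shows "pderiv_h \<T> j v x = d"
  using assms vector_derivative_at by (auto simp: pderiv_h_def mesh_interior_def)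

lemma pderiv_h_cong:
  assumes "\<And>y. y \<in> cbox a b \<Longrightarrow> v y = w y"
  shows "pderiv_h \<T> j v x = pderiv_h \<T> j w x"
proof (cases "x \<in> mesh_interior")
  case True
  have "open ((\<lambda>s. x + s *\<^sub>R axis j 1) -` mesh_interior)"
    by (intro open_vimage open_mesh_interior continuous_intros)
  then have "eventually (\<lambda>s. s \<in> (\<lambda>s. x + s *\<^sub>R axis j 1) -` mesh_interior) (nhds 0)"
    using True by (intro eventually_nhds_in_open) auto
  then have "eventually (\<lambda>s. s \<in> UNIV \<longrightarrow> v (x + s *\<^sub>R axis j 1) = w (x + s *\<^sub>R axis j 1)) (nhds 0)"
    by (rule eventually_mono) (use assms mesh_interior_subset in auto)
  then show ?thesis
    unfolding pderiv_h_def by (simp cong: vector_derivative_cong_eq[OF _ refl refl UNIV_I])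
qed (simp add: pderiv_h_off)

lemma piece_axis_deriv:
  assumes v: "piecewise_C1 \<T> j v" and K: "K \<in> \<T>"
  obtains p q where "axis_deriv j p q" "\<forall>x\<in>K. v x = p x"
    "\<forall>x\<in>interior K.
      ((\<lambda>s. v (x + s *\<^sub>R axis j 1)) has_vector_derivative q x) (at 0) \<and> pderiv_h \<T> j v x = q x"
proof -
  obtain p q where p: "axis_deriv j p q" "\<And>x. x \<in> K \<Longrightarrow> v x = p x"
    using v K by (auto simp: piecewise_C1_def C1_along_def) 
  have vd: "((\<lambda>s. v (x + s *\<^sub>R axis j 1)) has_vector_derivative q x) (at 0)"
    if x: "x \<in> interior K" for x
  proof (rule has_vector_derivative_transform_within_open)
    have "((\<lambda>s. p (x + s *\<^sub>R axis j 1)) has_vector_derivative q (x + 0 *\<^sub>R axis j 1)) (at 0)"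
      using p(1) unfolding axis_deriv_def by blast
    then show "((\<lambda>s. p (x + s *\<^sub>R axis j 1)) has_vector_derivative q x) (at 0)" by simp
    show "open ((\<lambda>s. x + s *\<^sub>R axis j 1) -` interior K)"
      by (intro open_vimage continuous_intros) auto
    show "p (x + s *\<^sub>R axis j 1) = v (x + s *\<^sub>R axis j 1)"
      if "s \<in> (\<lambda>s. x + s *\<^sub>R axis j 1) -` interior K" for s
      using that p(2) interior_subset by fastforce
  qed (use x in auto)
  moreover have "x \<in> mesh_interior" if "x \<in> interior K" for x
    using that K by (auto simp: mesh_interior_def)
  ultimately show ?thesis
    using p by (intro that[of p q]) (auto intro: pderiv_h_eqI)
qed

lemma has_pderiv_h:
  assumes "piecewise_C1 \<T> j v" "x \<in> mesh_interior"
  shows "((\<lambda>s. v (x + s *\<^sub>R axis j 1)) has_vector_derivative pderiv_h \<T> j v x) (at 0)"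
proof -
  obtain K where K: "K \<in> \<T>" "x \<in> interior K"
    using assms(2) by (auto simp: mesh_interior_def)
  show ?thesis
    by (rule piece_axis_deriv[OF assms(1) K(1)]) (use K(2) in auto)
qed

text \<open>
  This and the following rules hold at every point, and not just almost everywhere, because the
  elementwise derivatives of all functions vanish off the interiors of the elements.
\<close>

lemma pderiv_h_mult:
  assumes "piecewise_C1 \<T> j v" "piecewise_C1 \<T> j w"
  shows "pderiv_h \<T> j (\<lambda>y. v y * w y) x = v x * pderiv_h \<T> j w x + pderiv_h \<T> j v x * w x"
proof (cases "x \<in> mesh_interior")
  case True
  show ?thesis
    using has_vector_derivative_mult[OF has_pderiv_h[OF assms(1) True] has_pderiv_h[OF assms(2) True]]
    by (intro pderiv_h_eqI True) simp
qed (simp add: pderiv_h_off)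

lemma pderiv_h_cnj:
  assumes "piecewise_C1 \<T> j v"
  shows "pderiv_h \<T> j (\<lambda>y. cnj (v y)) x = cnj (pderiv_h \<T> j v x)"
proof (cases "x \<in> mesh_interior")
  case True
  show ?thesis
    by (intro pderiv_h_eqI True has_vector_derivative_cnj has_pderiv_h assms)
qed (simp add: pderiv_h_off)

lemma pderiv_h_sum:
  assumes "\<And>i. i \<in> I \<Longrightarrow> piecewise_C1 \<T> j (v i)"
  shows "pderiv_h \<T> j (\<lambda>y. \<Sum>i\<in>I. v i y) x = (\<Sum>i\<in>I. pderiv_h \<T> j (v i) x)"
proof (cases "x \<in> mesh_interior")
  case True
  show ?thesis
    by (intro pderiv_h_eqI True has_vector_derivative_sum has_pderiv_h assms)
qed (simp add: pderiv_h_off)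

lemma pderiv_h_cmult:
  assumes "piecewise_C1 \<T> j v"
  shows "pderiv_h \<T> j (\<lambda>y. c * v y) x = c * pderiv_h \<T> j v x"
proof (cases "x \<in> mesh_interior")
  case True
  show ?thesis
    by (intro pderiv_h_eqI True has_vector_derivative_mult_right has_pderiv_h assms)
qed (simp add: pderiv_h_off)

lemma pderiv_h_measurable:
  assumes "piecewise_C1 \<T> j v"
  shows "pderiv_h \<T> j v \<in> borel_measurable borel"
proof -
  have "continuous_on (interior K) (pderiv_h \<T> j v)" if K: "K \<in> \<T>" for K
  proof -
    obtain p q where "axis_deriv j p q" and
      "\<forall>x\<in>interior K.
        ((\<lambda>s. v (x + s *\<^sub>R axis j 1)) has_vector_derivative q x) (at 0) \<and> pderiv_h \<T> j v x = q x"
      by (rule piece_axis_deriv[OF assms K]) (rule that)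
    then have "continuous_on (interior K) q" "\<And>x. x \<in> interior K \<Longrightarrow> pderiv_h \<T> j v x = q x"
      using continuous_on_subset[of UNIV q "interior K"] by (simp_all add: axis_deriv_def)
    then show ?thesis
      by (simp cong: continuous_on_cong)
  qed
  then have "continuous_on mesh_interior (pderiv_h \<T> j v)"
    unfolding mesh_interior_def by (intro continuous_on_open_UN) auto
  then have "(\<lambda>x. indicator mesh_interior x *\<^sub>R pderiv_h \<T> j v x) \<in> borel_measurable borel"
    by (intro borel_measurable_continuous_on_indicator) (auto simp: open_mesh_interior)
  also have "(\<lambda>x. indicator mesh_interior x *\<^sub>R pderiv_h \<T> j v x) = pderiv_h \<T> j v"
    by (auto simp: fun_eq_iff indicator_def pderiv_h_off)
  finally show ?thesis .
qed

lemma piece_bound: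
  assumes v: "piecewise_C1 \<T> j v"
  obtains p q M where "0 \<le> M"
    "\<forall>K\<in>\<T>. axis_deriv j (p K) (q K) \<and> (\<forall>x\<in>K. v x = p K x) \<and>
       (\<forall>x\<in>cbox a b. norm (q K x) \<le> M) \<and> (\<forall>x\<in>interior K. pderiv_h \<T> j v x = q K x)"
proof -
  have "\<forall>K\<in>\<T>. \<exists>p q M. axis_deriv j p q \<and> (\<forall>x\<in>K. v x = p x) \<and>
      (\<forall>x\<in>cbox a b. norm (q x) \<le> M) \<and> (\<forall>x\<in>interior K. pderiv_h \<T> j v x = q x)"
  proof
    fix K assume K: "K \<in> \<T>"
    obtain p q where q: "axis_deriv j p q" "\<forall>x\<in>K. v x = p x" and
      "\<forall>x\<in>interior K.
        ((\<lambda>s. v (x + s *\<^sub>R axis j 1)) has_vector_derivative q x) (at 0) \<and> pderiv_h \<T> j v x = q x"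
      by (rule piece_axis_deriv[OF assms K]) (rule that)
    moreover have "bounded (q ` cbox a b)"
      using q(1) continuous_on_subset[OF _ subset_UNIV] unfolding axis_deriv_def
      by (intro compact_imp_bounded compact_continuous_image) auto
    ultimately show "\<exists>p q M. axis_deriv j p q \<and> (\<forall>x\<in>K. v x = p x) \<and>
      (\<forall>x\<in>cbox a b. norm (q x) \<le> M) \<and> (\<forall>x\<in>interior K. pderiv_h \<T> j v x = q x)"
      unfolding bounded_iff by (intro exI[of _ p] exI[of _ q]) auto
  qed
  then obtain p q M where pq:
    "\<And>K. K \<in> \<T> \<Longrightarrow> axis_deriv j (p K) (q K) \<and> (\<forall>x\<in>K. v x = p K x) \<and>
      (\<forall>x\<in>cbox a b. norm (q K x) \<le> M K) \<and> (\<forall>x\<in>interior K. pderiv_h \<T> j v x = q K x)"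
    by metis
  have M: "M K \<le> (\<Sum>K\<in>\<T>. \<bar>M K\<bar>)" if "K \<in> \<T>" for K
    using member_le_sum[of K \<T> "\<lambda>K. \<bar>M K\<bar>"] that finite_mesh by force
  show ?thesis
  proof (rule that[of "\<Sum>K\<in>\<T>. \<bar>M K\<bar>" p q])
    show "0 \<le> (\<Sum>K\<in>\<T>. \<bar>M K\<bar>)" by (simp add: sum_nonneg)
  next
    show "\<forall>K\<in>\<T>. axis_deriv j (p K) (q K) \<and> (\<forall>x\<in>K. v x = p K x) \<and>
       (\<forall>x\<in>cbox a b. norm (q K x) \<le> (\<Sum>K\<in>\<T>. \<bar>M K\<bar>)) \<and>
       (\<forall>x\<in>interior K. pderiv_h \<T> j v x = q K x)"
    proof
      fix K assume K: "K \<in> \<T>"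
      have "norm (q K x) \<le> (\<Sum>K\<in>\<T>. \<bar>M K\<bar>)" if "x \<in> cbox a b" for x
        using pq[OF K] M[OF K] that by force
      then show "axis_deriv j (p K) (q K) \<and> (\<forall>x\<in>K. v x = p K x) \<and>
         (\<forall>x\<in>cbox a b. norm (q K x) \<le> (\<Sum>K\<in>\<T>. \<bar>M K\<bar>)) \<and>
         (\<forall>x\<in>interior K. pderiv_h \<T> j v x = q K x)"
        using pq[OF K] by simp
    qed
  qed
qed

lemma pderiv_h_bounded:
  assumes "piecewise_C1 \<T> j v"
  obtains M where "0 \<le> M" "\<And>x. norm (pderiv_h \<T> j v x) \<le> M"
proof -
  obtain p q M where M: "0 \<le> M"
    "\<forall>K\<in>\<T>. axis_deriv j (p K) (q K) \<and> (\<forall>x\<in>K. v x = p K x) \<and>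
       (\<forall>x\<in>cbox a b. norm (q K x) \<le> M) \<and> (\<forall>x\<in>interior K. pderiv_h \<T> j v x = q K x)"
    by (rule piece_bound[OF assms]) (rule that)
  have "norm (pderiv_h \<T> j v x) \<le> M" for x
  proof (cases "x \<in> mesh_interior")
    case True
    then obtain K where "K \<in> \<T>" "x \<in> interior K" by (auto simp: mesh_interior_def)
    with M(2) True mesh_interior_subset show ?thesis by force
  qed (use M in \<open>simp add: pderiv_h_off\<close>)
  with M show ?thesis using that by blast
qed

text \<open>
  A segment inside the box is covered by the finitely many closed sets
  where it meets an element. On each of these sets \<open>v\<close> coincides with a function that is Lipschitz
  along the whole segment, and a Lipschitz bound on finitely many closed sets covering an
  interval holds on the interval.
\<close>

lemma piecewise_C1_lipschitz_along:
  assumes "piecewise_C1 \<T> j v"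
  obtains M where "0 \<le> M"
    "\<And>x s. x \<in> cbox a b \<Longrightarrow> x + s *\<^sub>R axis j 1 \<in> cbox a b \<Longrightarrow> 0 \<le> s \<Longrightarrow>
       norm (v (x + s *\<^sub>R axis j 1) - v x) \<le> M * s"
proof -
  obtain p q M where M: "0 \<le> M"
    "\<forall>K\<in>\<T>. axis_deriv j (p K) (q K) \<and> (\<forall>x\<in>K. v x = p K x) \<and>
       (\<forall>x\<in>cbox a b. norm (q K x) \<le> M) \<and> (\<forall>x\<in>interior K. pderiv_h \<T> j v x = q K x)"
    by (rule piece_bound[OF assms]) (rule that)
  have "norm (v (x + s *\<^sub>R axis j 1) - v x) \<le> M * s"
    if x: "x \<in> cbox a b" "x + s *\<^sub>R axis j 1 \<in> cbox a b" "0 \<le> s" for x s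
  proof -
    have inside: "x + t *\<^sub>R axis j 1 \<in> cbox a b" if "t \<in> {0..s}" for t
    proof -
      have "x $ i \<le> (x + t *\<^sub>R axis j 1) $ i \<and> (x + t *\<^sub>R axis j 1) $ i \<le> (x + s *\<^sub>R axis j 1) $ i" for i
        using that by (auto simp: axis_def)
      with x show ?thesis unfolding mem_box_cart by (meson order_trans)
    qed
    define C where "C K = {0..s} \<inter> (\<lambda>t. x + t *\<^sub>R axis j 1) -` K" for K
    have "M-lipschitz_on {0..s} (\<lambda>t. v (x + t *\<^sub>R axis j 1))"
    proof (rule lipschitz_on_closed_Union[where I = \<T> and U = C])
      fix K assume K: "K \<in> \<T>"
      have "M-lipschitz_on {0..s} (\<lambda>t. p K (x + t *\<^sub>R axis j 1))"
        using M K inside by (intro axis_deriv_lipschitz[where q = "q K"]) auto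
      then have "M-lipschitz_on (C K) (\<lambda>t. p K (x + t *\<^sub>R axis j 1))"
        by (rule lipschitz_on_subset) (auto simp: C_def)
      then show "M-lipschitz_on (C K) (\<lambda>t. v (x + t *\<^sub>R axis j 1))"
        using bspec[OF M(2) K] by (auto simp: lipschitz_on_def C_def)
      show "closed (C K)"
        unfolding C_def
        by (intro closed_Int closed_vimage closed_element K continuous_intros)
    next
      show "{0..s} \<subseteq> (\<Union>K\<in>\<T>. C K)"
      proof
        fix t assume "t \<in> {0..s}"
        then show "t \<in> (\<Union>K\<in>\<T>. C K)"
          using inside[of t] Union_mesh by (auto simp: C_def)
      qed
    qed (use M finite_mesh in auto)
    from lipschitz_onD[OF this, of s 0] x(3) show ?thesis
      by (simp add: dist_norm)
  qed
  with M(1) show ?thesis using that by blast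
qed

end

section \<open>The integral of the derivative of a periodic function\<close>

lemma integral_translate:
  fixes g :: "'a::euclidean_space \<Rightarrow> 'b::{banach, second_countable_topology}"
  assumes "integrable lborel g"
  shows "integrable lborel (\<lambda>x. g (x + c))" "(LINT x|lborel. g (x + c)) = (LINT x|lborel. g x)"
proof -
  have g: "g \<in> borel_measurable borel" using assms by auto
  have "integrable (distr lborel borel ((+) c)) g"
    using assms by (simp add: lborel_distr_plus)
  then show "integrable lborel (\<lambda>x. g (x + c))"
    using g by (subst (asm) integrable_distr_eq) (auto simp: add.commute)
  have "(LINT x|lborel. g x) = (LINT x|distr lborel borel ((+) c). g x)"
    by (simp add: lborel_distr_plus)
  also have "\<dots> = (LINT x|lborel. g (c + x))"
    using g by (intro integral_distr) auto
  finally show "(LINT x|lborel. g (x + c)) = (LINT x|lborel. g x)"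
    by (simp add: add.commute)
qed

lemma has_vector_derivative_imp_quotient_tendsto:
  fixes g :: "real \<Rightarrow> 'a::real_normed_vector"
  assumes "(g has_vector_derivative d) (at 0)"
  shows "((\<lambda>s. (g s - g 0) /\<^sub>R s) \<longlongrightarrow> d) (at 0)"
proof (rule LIM_zero_cancel, rule tendsto_norm_zero_cancel)
  have 1: "((\<lambda>s. norm (g s - g 0 - s *\<^sub>R d) / norm s) \<longlongrightarrow> 0) (at 0)"
    using assms by (simp add: has_vector_derivative_def has_derivative_iff_norm)
  have *: "norm (g s - g 0 - s *\<^sub>R d) / norm s = norm ((g s - g 0) /\<^sub>R s - d)" if "s \<noteq> 0" for s
  proof -
    have "(g s - g 0) /\<^sub>R s - d = (g s - g 0 - s *\<^sub>R d) /\<^sub>R s"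
      using that by (simp add: scaleR_diff_right)
    then show ?thesis by (simp add: divide_inverse)
  qed
  have "eventually (\<lambda>s. norm (g s - g 0 - s *\<^sub>R d) / norm s = norm ((g s - g 0) /\<^sub>R s - d)) (at 0)"
    unfolding eventually_at_filter using * by (intro always_eventually) blast
  with 1 show "((\<lambda>s. norm ((g s - g 0) /\<^sub>R s - d)) \<longlongrightarrow> 0) (at 0)"
    by (rule Lim_transform_eventually)
qed

lemma add_axis_nth: "(x + s *\<^sub>R axis j (1::real)) $ i = (if i = j then x $ i + s else x $ i)"
  by (simp add: axis_def)

context box_partition
begin

text \<open>
  Shifting a point of the box by \<open>s\<close> in direction \<open>j\<close>, and back by the side length \<open>L\<close> if it has
  left the box, changes the value of \<open>v\<close> by \<open>O(s)\<close>. For a point that wraps around, the estimate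
  goes through the two opposite faces, on which \<open>v\<close> takes equal values.
\<close>

lemma shift_difference_bound:
  assumes per: "periodic_on_box a b v" and v: "piecewise_C1 \<T> j v"
  defines "L \<equiv> b $ j - a $ j" and "e \<equiv> axis j (1::real)"
  obtains M where "0 \<le> M"
    "\<forall>x s. x \<in> box a b \<longrightarrow> 0 < s \<longrightarrow> s < L \<longrightarrow> x $ j + s < b $ j \<longrightarrow>
       norm (v (x + s *\<^sub>R e) - v x) \<le> M * s"
    "\<forall>x s. x \<in> box a b \<longrightarrow> 0 < s \<longrightarrow> s < L \<longrightarrow> b $ j < x $ j + s \<longrightarrow>
       norm (v (x + (s - L) *\<^sub>R e) - v x) \<le> M * s"
proof (rule piecewise_C1_lipschitz_along[OF v])
  fix M assume M: "0 \<le> M"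
    "\<And>x s. x \<in> cbox a b \<Longrightarrow> x + s *\<^sub>R axis j 1 \<in> cbox a b \<Longrightarrow> 0 \<le> s \<Longrightarrow>
       norm (v (x + s *\<^sub>R axis j 1) - v x) \<le> M * s"
  have L: "0 < L" using side_pos by (simp add: L_def)
  show ?thesis
  proof (rule that[OF M(1)]; intro allI impI)
    fix x s assume x: "x \<in> box a b" "0 < s" "s < L" "x $ j + s < b $ j"
    then have "x + s *\<^sub>R e \<in> cbox a b"
      using less_imp_le[of "a $ _" "x $ _"] less_imp_le[of "x $ _" "b $ _"]
      unfolding e_def mem_box_cart add_axis_nth by (smt (verit))
    then show "norm (v (x + s *\<^sub>R e) - v x) \<le> M * s"
      using M(2)[of x s] x box_subset_cbox unfolding e_def by fastforce
  next
    fix x s assume x: "x \<in> box a b" "0 < s" "s < L" "b $ j < x $ j + s"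
    define z0 where "z0 = x + (a $ j - x $ j) *\<^sub>R e"
    define z1 where "z1 = x + (b $ j - x $ j) *\<^sub>R e"
    define z where "z = x + (s - L) *\<^sub>R e"
    have x': "a $ i < x $ i" "x $ i < b $ i" for i
      using x by (auto simp: mem_box_cart)
    have "x $ j + (s - L) \<le> b $ j" "a $ j \<le> x $ j + (s - L)"
      using x x'(2)[of j] unfolding L_def by linarith+
    then have cb: "z0 \<in> cbox a b" "z1 \<in> cbox a b" "z \<in> cbox a b" "x \<in> cbox a b"
      using x'(1)[THEN less_imp_le] x'(2)[THEN less_imp_le] side_pos[THEN less_imp_le]
      unfolding z0_def z1_def z_def e_def mem_box_cart add_axis_nth
      by simp_all
    have "z1 = z0 + (b $ j - a $ j) *\<^sub>R axis j 1" "z0 $ j = a $ j"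
      unfolding z0_def z1_def e_def by (simp_all add: add_axis_nth algebra_simps)
    then have eq: "v z1 = v z0"
      using per cb(1) by (auto simp: periodic_on_box_def)
    have zz: "z = z0 + (x $ j + s - b $ j) *\<^sub>R axis j 1"
      unfolding z0_def z_def e_def L_def by (simp add: algebra_simps)
    have "norm (v z - v z0) \<le> M * (x $ j + s - b $ j)"
      using M(2)[of z0 "x $ j + s - b $ j"] cb x zz by simp
    moreover have "norm (v z1 - v x) \<le> M * (b $ j - x $ j)"
      using M(2)[of x "b $ j - x $ j"] cb x'(2)[of j] by (simp add: z1_def e_def)
    moreover have "norm (v z - v x) \<le> norm (v z - v z0) + norm (v z1 - v x)"
      using norm_triangle_ineq[of "v z - v z0" "v z1 - v x"] eq by simp
    ultimately have "norm (v z - v x) \<le> M * (x $ j + s - b $ j) + M * (b $ j - x $ j)"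
      by linarith
    also have "\<dots> = M * s" by (simp add: algebra_simps)
    finally show "norm (v (x + (s - L) *\<^sub>R e) - v x) \<le> M * s" by (simp add: z_def)
  qed
qed

text \<open>
  This is the divergence theorem without boundary terms; applied to a product it gives integration
  by parts. A cyclic shift of the box in direction \<open>j\<close> preserves the integral, so the difference
  quotients \<open>Q s\<close> of \<open>v\<close> along the cyclic shift have integral \<open>0\<close>. They are bounded uniformly by the
  Lipschitz constant and converge to the derivative in the interiors of the elements, hence almost
  everywhere, so dominated convergence applies.
\<close>

lemma integral_pderiv_h_eq_0:
  assumes cont: "continuous_on (cbox a b) v" and per: "periodic_on_box a b v"
    and v: "piecewise_C1 \<T> j v"
  shows "(LINT x:box a b|lborel. pderiv_h \<T> j v x) = 0"
proof -
  define L e where "L = b $ j - a $ j" and "e = axis j (1::real)"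
  have L: "0 < L" using side_pos by (simp add: L_def)
  define G where "G x = indicator (box a b) x *\<^sub>R v x" for x
  define A where "A s x = (if a $ j + s < x $ j then G x else 0)" for s x
  define B where "B s x = (if x $ j < a $ j + s then G x else 0)" for s x
  \<comment> \<open>\<open>A s\<close> and \<open>B s\<close> are the parts of \<open>G\<close> on the two sides of the hyperplane \<open>x $ j = a $ j + s\<close>.
    The values of \<open>G\<close> seen by the cyclic shift are those of translates of \<open>A s\<close> and \<open>B s\<close>.\<close>
  define Q where "Q s x = (A s (x + s *\<^sub>R e) + B s (x + (s - L) *\<^sub>R e) - G x) /\<^sub>R s" for s x
  have G: "integrable lborel G"
    using set_integrable_continuous_box[OF cont] by (simp add: set_integrable_def G_def[abs_def])
  have Gm [measurable]: "G \<in> borel_measurable borel"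
    using G by auto
  have A: "integrable lborel (A s)" and B: "integrable lborel (B s)" for s
  proof -
    have [measurable]: "(\<lambda>x. x $ j) \<in> borel_measurable (borel :: (real^'d) measure)"
      by (intro borel_measurable_continuous_onI continuous_intros)
    have "A s \<in> borel_measurable borel" "B s \<in> borel_measurable borel"
      unfolding A_def[abs_def] B_def[abs_def] by measurable
    then show "integrable lborel (A s)" "integrable lborel (B s)"
      by (auto intro!: Bochner_Integration.integrable_bound[OF G] simp: A_def B_def)
  qed
  have Q_int: "integrable lborel (Q s)" "integral\<^sup>L lborel (Q s) = 0" for s
  proof -
    note AB = integral_translate[OF A[of s], of "s *\<^sub>R e"]
      integral_translate[OF B[of s], of "(s - L) *\<^sub>R e"]
    show "integrable lborel (Q s)"
      unfolding Q_def using AB G by simp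
    have "AE x in lborel. A s x + B s x = G x"
      using AE_coordinate_neq[of j "a $ j + s"] by eventually_elim (auto simp: A_def B_def)
    then have "(LINT x|lborel. A s x + B s x) = (LINT x|lborel. G x)"
      using A[of s] B[of s] by (intro integral_cong_AE) auto
    then have "(LINT x|lborel. A s x) + (LINT x|lborel. B s x) = (LINT x|lborel. G x)"
      using A[of s] B[of s] by simp
    then show "integral\<^sup>L lborel (Q s) = 0"
      unfolding Q_def using AB G by simp
  qed
  have all_split: "(\<forall>i. P i) \<longleftrightarrow> (\<forall>i. i \<noteq> j \<longrightarrow> P i) \<and> P j" for P :: "'d \<Rightarrow> bool"
    by auto
  have shift: "x + t *\<^sub>R e \<in> box a b \<longleftrightarrow>
      (\<forall>i. i \<noteq> j \<longrightarrow> a $ i < x $ i \<and> x $ i < b $ i) \<and> a $ j < x $ j + t \<and> x $ j + t < b $ j" for x t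
    unfolding e_def mem_box_cart add_axis_nth by (subst all_split) simp
  have ej: "(x + t *\<^sub>R e) $ j = x $ j + t" for x t
    by (simp add: e_def add_axis_nth)
  have ei: "i \<noteq> j \<Longrightarrow> e $ i = 0" for i
    by (simp add: e_def axis_def)
  have box: "x \<in> box a b \<longleftrightarrow>
      (\<forall>i. i \<noteq> j \<longrightarrow> a $ i < x $ i \<and> x $ i < b $ i) \<and> a $ j < x $ j \<and> x $ j < b $ j" for x
    using shift[of x 0] by simp
  have Q_off: "Q s x = 0" if "x \<notin> box a b" "0 < s" "s < L" for s x
  proof -
    have "A s (x + s *\<^sub>R e) = 0" "B s (x + (s - L) *\<^sub>R e) = 0" "G x = 0"
      using that unfolding A_def B_def G_def indicator_def shift ej box L_def by (auto simp: ei)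
    then show ?thesis by (simp add: Q_def)
  qed
  have Q_left: "Q s x = (v (x + s *\<^sub>R e) - v x) /\<^sub>R s"
    if "x \<in> box a b" "0 < s" "s < L" "x $ j + s < b $ j" for s x
  proof -
    have "A s (x + s *\<^sub>R e) = v (x + s *\<^sub>R e)" "B s (x + (s - L) *\<^sub>R e) = 0" "G x = v x"
      using that unfolding A_def B_def G_def indicator_def shift ej box L_def by (auto simp: ei)
    then show ?thesis by (simp add: Q_def)
  qed
  have Q_right: "Q s x = (v (x + (s - L) *\<^sub>R e) - v x) /\<^sub>R s"
    if "x \<in> box a b" "0 < s" "s < L" "b $ j < x $ j + s" for s x
  proof -
    have "A s (x + s *\<^sub>R e) = 0" "B s (x + (s - L) *\<^sub>R e) = v (x + (s - L) *\<^sub>R e)" "G x = v x"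
      using that unfolding A_def B_def G_def indicator_def shift ej box L_def by (auto simp: ei)
    then show ?thesis by (simp add: Q_def)
  qed
  obtain M where M: "0 \<le> M"
    "\<forall>x s. x \<in> box a b \<longrightarrow> 0 < s \<longrightarrow> s < L \<longrightarrow> x $ j + s < b $ j \<longrightarrow>
       norm (v (x + s *\<^sub>R e) - v x) \<le> M * s"
    "\<forall>x s. x \<in> box a b \<longrightarrow> 0 < s \<longrightarrow> s < L \<longrightarrow> b $ j < x $ j + s \<longrightarrow>
       norm (v (x + (s - L) *\<^sub>R e) - v x) \<le> M * s"
    by (rule shift_difference_bound[OF per v, folded L_def e_def]) (rule that)
  have scaled: "norm (w /\<^sub>R s) \<le> M" if "0 < s" "norm w \<le> M * s" for w :: complex and s
    using that by (simp add: field_simps)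
  have Q_bound: "norm (Q s x) \<le> M * indicator (box a b) x"
    if s: "0 < s" "s < L" and x: "x $ j \<noteq> b $ j - s" for s x
  proof -
    consider "x \<notin> box a b" | "x \<in> box a b" "x $ j + s < b $ j" | "x \<in> box a b" "b $ j < x $ j + s"
      using x by argo
    then show ?thesis
    proof cases
      case 1 then show ?thesis using Q_off s by simp
    next
      case 2
      then have "norm (v (x + s *\<^sub>R e) - v x) \<le> M * s" using M(2) s by blast
      then show ?thesis unfolding Q_left[OF 2(1) s 2(2)] using scaled[OF s(1)] 2(1) by simp
    next
      case 3
      then have "norm (v (x + (s - L) *\<^sub>R e) - v x) \<le> M * s" using M(3) s by blast
      then show ?thesis unfolding Q_right[OF 3(1) s 3(2)] using scaled[OF s(1)] 3(1) by simp
    qed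
  qed
  \<comment> \<open>The offset 2 keeps the step sizes strictly below \<open>L\<close>.\<close>
  define \<sigma> where "\<sigma> n = L / (real n + 2)" for n
  have \<sigma>: "0 < \<sigma> n" "\<sigma> n < L" for n
    using L by (auto simp: \<sigma>_def field_simps add_pos_nonneg)
  have \<sigma>_lim: "\<sigma> \<longlonglongrightarrow> 0"
    using LIMSEQ_ignore_initial_segment[OF lim_const_over_n[of L], of 2]
    by (simp add: \<sigma>_def[abs_def] add.commute)
  have Q_lim: "(\<lambda>n. Q (\<sigma> n) x) \<longlonglongrightarrow> indicator (box a b) x *\<^sub>R pderiv_h \<T> j v x"
    if "x \<in> box a b \<longrightarrow> x \<in> mesh_interior" for x
  proof (cases "x \<in> box a b")
    case True
    have "((\<lambda>s. (v (x + s *\<^sub>R e) - v (x + 0 *\<^sub>R e)) /\<^sub>R s) \<longlongrightarrow> pderiv_h \<T> j v x) (at 0)"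
      unfolding e_def using that True
      by (intro has_vector_derivative_imp_quotient_tendsto has_pderiv_h v) auto
    then have "((\<lambda>s. (v (x + s *\<^sub>R e) - v x) /\<^sub>R s) \<longlongrightarrow> pderiv_h \<T> j v x) (at 0)"
      by simp
    moreover have "filterlim \<sigma> (at 0) sequentially"
      using \<sigma>_lim \<sigma>(1) by (auto simp: filterlim_at less_imp_neq[symmetric])
    ultimately have "(\<lambda>n. (v (x + \<sigma> n *\<^sub>R e) - v x) /\<^sub>R \<sigma> n) \<longlonglongrightarrow> pderiv_h \<T> j v x"
      by (rule filterlim_compose)
    moreover have "eventually (\<lambda>n. \<sigma> n < b $ j - x $ j) sequentially"
      using \<sigma>_lim True by (intro order_tendstoD(2)) (auto simp: mem_box_cart)
    then have "eventually (\<lambda>n. (v (x + \<sigma> n *\<^sub>R e) - v x) /\<^sub>R \<sigma> n = Q (\<sigma> n) x) sequentially"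
      by eventually_elim (use True \<sigma> in \<open>auto simp: Q_left\<close>)
    ultimately have "(\<lambda>n. Q (\<sigma> n) x) \<longlonglongrightarrow> pderiv_h \<T> j v x"
      by (rule Lim_transform_eventually)
    then show ?thesis using True by simp
  next
    case False
    then show ?thesis using Q_off \<sigma> by simp
  qed
  have "(\<lambda>n. integral\<^sup>L lborel (Q (\<sigma> n))) \<longlonglongrightarrow>
      (LINT x|lborel. indicator (box a b) x *\<^sub>R pderiv_h \<T> j v x)"
  proof (rule integral_dominated_convergence[where w = "\<lambda>x. M * indicator (box a b) x"])
    show "(\<lambda>x. indicator (box a b) x *\<^sub>R pderiv_h \<T> j v x) \<in> borel_measurable lborel"
      using pderiv_h_measurable[OF v] by measurable
    show "Q (\<sigma> n) \<in> borel_measurable lborel" for n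
      using Q_int(1) by (rule borel_measurable_integrable)
    show "integrable lborel (\<lambda>x. M * indicator (box a b) x)"
      by (simp add: emeasure_lborel_box_eq)
    show "AE x in lborel. (\<lambda>n. Q (\<sigma> n) x) \<longlonglongrightarrow> indicator (box a b) x *\<^sub>R pderiv_h \<T> j v x"
      using AE_mesh_interior by eventually_elim (rule Q_lim)
    show "AE x in lborel. norm (Q (\<sigma> n) x) \<le> M * indicator (box a b) x" for n
      using AE_coordinate_neq[of j "b $ j - \<sigma> n"] by eventually_elim (rule Q_bound[OF \<sigma>])
  qed
  then show ?thesis
    using LIMSEQ_unique[OF _ tendsto_const] by (simp add: Q_int set_lebesgue_integral_def)
qed

end

section \<open>Calculus in time\<close>

definition time_poly :: "nat \<Rightarrow> (nat \<Rightarrow> complex) \<Rightarrow> real \<Rightarrow> complex" where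
  "time_poly k c t = (\<Sum>l\<le>k. of_real (t ^ l) * c l)"

definition time_poly_deriv :: "nat \<Rightarrow> (nat \<Rightarrow> complex) \<Rightarrow> real \<Rightarrow> complex" where
  "time_poly_deriv k c t = (\<Sum>l\<le>k. of_real (real l * t ^ (l - 1)) * c l)"

lemma has_vector_derivative_time_poly:
  "(time_poly k c has_vector_derivative time_poly_deriv k c t) (at t within S)"
proof -
  have "((\<lambda>t. of_real (t ^ l) * c l) has_vector_derivative of_real (real l * t ^ (l - 1)) * c l)
      (at t within S)" for l
    by (intro has_vector_derivative_mult_left has_vector_derivative_of_real)
      (auto intro!: derivative_eq_intros simp flip: has_real_derivative_iff_has_vector_derivative)
  then show ?thesis
    unfolding time_poly_def[abs_def] time_poly_deriv_def by (intro has_vector_derivative_sum)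
qed

text \<open>
  As \<open>f\<close> is merely a derivative, the integrand may be discontinuous in time. The fundamental theorem
  of calculus holds for the gauge integral whenever there is a derivative at every point.
  With \<open>F s = s\<close> and \<open>f s = 1\<close> the lemma also covers the mass and the gradient term.
\<close>

lemma has_integral_potential:
  fixes F f :: "real \<Rightarrow> real"
  assumes F: "\<And>s. 0 \<le> s \<Longrightarrow> (F has_real_derivative f s) (at s within {0..})" and "t0 \<le> t1"
    and P: "\<And>t. (P has_vector_derivative P' t) (at t within {t0..t1})"
  shows "((\<lambda>t. f ((cmod (P t))\<^sup>2) * Re (P' t * cnj (P t))) has_integral
           (F ((cmod (P t1))\<^sup>2) - F ((cmod (P t0))\<^sup>2)) / 2) {t0..t1}"
proof -
  let ?g = "\<lambda>t. (cmod (P t))\<^sup>2"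
  have "((\<lambda>t. F (?g t)) has_vector_derivative f (?g t) * (2 * Re (P' t * cnj (P t))))
      (at t within {t0..t1})" for t
  proof -
    have "((\<lambda>t. P t * cnj (P t)) has_vector_derivative P t * cnj (P' t) + P' t * cnj (P t))
        (at t within {t0..t1})"
      by (intro has_vector_derivative_mult has_vector_derivative_cnj P)
    from bounded_linear.has_vector_derivative[OF bounded_linear_Re this]
    have "(?g has_real_derivative 2 * Re (P' t * cnj (P t))) (at t within {t0..t1})"
      unfolding cmod_power2
      by (simp add: has_real_derivative_iff_has_vector_derivative power2_eq_square algebra_simps)
    moreover have "(F has_real_derivative f (?g t)) (at (?g t) within ?g ` {t0..t1})"
      by (rule has_field_derivative_subset[OF F]) auto
    ultimately have "(F \<circ> ?g has_real_derivative f (?g t) * (2 * Re (P' t * cnj (P t))))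
        (at t within {t0..t1})"
      by (intro DERIV_image_chain)
    then show ?thesis
      by (simp add: has_real_derivative_iff_has_vector_derivative o_def)
  qed
  from fundamental_theorem_of_calculus[OF \<open>t0 \<le> t1\<close> this]
  have "((\<lambda>t. f (?g t) * (2 * Re (P' t * cnj (P t)))) has_integral F (?g t1) - F (?g t0)) {t0..t1}" .
  from has_integral_divide[OF this, of 2] show ?thesis
    by (simp only: mult.left_commute[of _ 2] nonzero_mult_div_cancel_left[OF zero_neq_numeral[symmetric]])
qed

text \<open>
  These numbers remain when the product of a polynomial in time and the derivative of another one
  is expanded in their coefficients and integrated over the slab.
\<close>

definition time_weight :: "real \<Rightarrow> real \<Rightarrow> nat \<Rightarrow> nat \<Rightarrow> complex" where
  "time_weight t0 t1 i l = of_real (integral {t0..t1} (\<lambda>t. t ^ i * (real l * t ^ (l - 1))))"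

lemma has_integral_time_poly_product:
  "((\<lambda>t. cnj (time_poly k c t) * time_poly_deriv k d t) has_integral
     (\<Sum>i\<le>k. \<Sum>l\<le>k. time_weight t0 t1 i l * (cnj (c i) * d l))) {t0..t1}"
proof -
  have "((\<lambda>t. complex_of_real (t ^ i * (real l * t ^ (l - 1))) * (cnj (c i) * d l)) has_integral
      time_weight t0 t1 i l * (cnj (c i) * d l)) {t0..t1}" for i l
    unfolding time_weight_def
    by (intro has_integral_mult_left has_integral_of_real integrable_integral
        integrable_continuous_real continuous_intros)
  then have "((\<lambda>t. \<Sum>i\<le>k. \<Sum>l\<le>k. complex_of_real (t ^ i * (real l * t ^ (l - 1))) * (cnj (c i) * d l))
      has_integral (\<Sum>i\<le>k. \<Sum>l\<le>k. time_weight t0 t1 i l * (cnj (c i) * d l))) {t0..t1}"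
    by (intro has_integral_sum) auto
  moreover have "(\<Sum>i\<le>k. \<Sum>l\<le>k. complex_of_real (t ^ i * (real l * t ^ (l - 1))) * (cnj (c i) * d l)) =
      cnj (time_poly k c t) * time_poly_deriv k d t" for t
    unfolding time_poly_def time_poly_deriv_def cnj_sum sum_product
    by (intro sum.cong refl) (simp add: mult_ac)
  ultimately show ?thesis by simp
qed

text \<open>
  Write \<open>p\<close> and \<open>q\<close> for the polynomials with coefficients \<open>c\<close> and \<open>d\<close>. The product rule shows that
  the derivative of \<open>Im (cnj p * q)\<close> is \<open>2 * Im (cnj p' * q) + Im (cnj p * q' + cnj q * p')\<close>, and the
  integrand of the lemma is \<open>Im (cnj p' * q)\<close>. When \<open>c\<close> are the values and \<open>d\<close> the spatial derivatives
  of coefficient functions, the term \<open>cnj p * q' + cnj q * p'\<close> is itself a spatial derivative, namely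
  that of \<open>cnj p * p'\<close>. Its time integral is therefore kept as an explicit sum over the coefficients.
\<close>

lemma has_integral_momentum:
  assumes "t0 \<le> t1"
  shows "((\<lambda>t. Re (\<i> * time_poly_deriv k c t * cnj (time_poly k d t))) has_integral
    (Im (cnj (time_poly k c t1) * time_poly k d t1) - Im (cnj (time_poly k c t0) * time_poly k d t0)
      - Im (\<Sum>i\<le>k. \<Sum>l\<le>k. time_weight t0 t1 i l * (cnj (c i) * d l + cnj (d i) * c l))) / 2) {t0..t1}"
proof -
  let ?c = "time_poly k c" and ?c' = "time_poly_deriv k c"
    and ?d = "time_poly k d" and ?d' = "time_poly_deriv k d"
  let ?W = "\<Sum>i\<le>k. \<Sum>l\<le>k. time_weight t0 t1 i l * (cnj (c i) * d l + cnj (d i) * c l)"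
  have 1: "((\<lambda>t. cnj (?c t) * ?d' t + cnj (?c' t) * ?d t) has_integral
      cnj (?c t1) * ?d t1 - cnj (?c t0) * ?d t0) {t0..t1}"
    by (intro fundamental_theorem_of_calculus assms has_vector_derivative_mult
        has_vector_derivative_cnj has_vector_derivative_time_poly)
  have 2: "((\<lambda>t. cnj (?c t) * ?d' t + cnj (?d t) * ?c' t) has_integral ?W) {t0..t1}"
    using has_integral_add[OF has_integral_time_poly_product[of k c d]
        has_integral_time_poly_product[of k d c]]
    by (simp add: distrib_left sum.distrib)
  have "Im (cnj p * q' + cnj p' * q - (cnj p * q' + cnj q * p')) / 2 = Re (\<i> * p' * cnj q)"
    for p p' q q'
    by (simp add: field_simps)
  with has_integral_divide[OF has_integral_Im[OF has_integral_diff[OF 1 2]], of 2]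
  show ?thesis
    by (simp only: minus_complex.simps)
qed

section \<open>Exchanging the order of integration\<close>

text \<open>
  Integrability on the slab allows the time integral to be taken first, for almost every fixed \<open>x\<close>, where it exists in the Lebesgue sense and
  hence agrees with a gauge integral supplied by the fundamental theorem of calculus.
\<close>

lemma Re_st_integral_eq:
  assumes g: "st_integrable a b t0 t1 g"
    and I: "set_integrable lborel (box a b) I"
    and has_int: "AE x in lborel. x \<in> box a b \<longrightarrow> ((\<lambda>t. Re (g t x)) has_integral I x) {t0..t1}"
  shows "Re (st_integral a b t0 t1 g) = (LINT x:box a b|lborel. I x)"
proof -
  define h where "h t x = indicator {t0..t1} t *\<^sub>R indicator (box a b) x *\<^sub>R g t x" for t x
  have "integrable (lborel \<Otimes>\<^sub>M lborel) (case_prod h)"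
    using g unfolding st_integrable_def set_integrable_def lborel_prod
    by (auto simp: h_def indicator_times case_prod_unfold elim!: back_subst[of "integrable lborel"])
  note h = this
  have "st_integral a b t0 t1 g = (LINT t|lborel. (LINT x|lborel. h t x))"
    by (simp add: st_integral_def set_lebesgue_integral_def h_def del: scaleR_scaleR)
  also have "\<dots> = (LINT x|lborel. (LINT t|lborel. h t x))"
    using lborel_pair.Fubini_integral[OF h] by simp
  finally have "Re (st_integral a b t0 t1 g) = (LINT x|lborel. Re (LINT t|lborel. h t x))"
    using lborel_pair.integrable_snd[OF h] by simp
  also have "\<dots> = (LINT x|lborel. indicator (box a b) x *\<^sub>R I x)"
  proof (rule integral_cong_AE)
    show "(\<lambda>x. Re (LINT t|lborel. h t x)) \<in> borel_measurable lborel"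
      using lborel_pair.integrable_snd[OF h] by (intro borel_measurable_integrable) simp
    show "(\<lambda>x. indicator (box a b) x *\<^sub>R I x) \<in> borel_measurable lborel"
      using I by (auto simp: set_integrable_def)
    show "AE x in lborel. Re (LINT t|lborel. h t x) = indicator (box a b) x *\<^sub>R I x"
      using lborel_pair.AE_integrable_snd[OF h] has_int
    proof eventually_elim
      case (elim x)
      show ?case
      proof (cases "x \<in> box a b")
        case True
        then have "set_integrable lborel {t0..t1} (\<lambda>t. g t x)"
          using elim(1) by (simp add: set_integrable_def h_def)
        from set_borel_integral_eq_integral[OF this]
        have "((\<lambda>t. g t x) has_integral (LINT t:{t0..t1}|lborel. g t x)) {t0..t1}"
          by (simp add: has_integral_integral)
        then have "Re (LINT t:{t0..t1}|lborel. g t x) = I x"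
          using has_integral_Re has_integral_unique elim(2) True by blast
        then show ?thesis
          using True by (simp add: set_lebesgue_integral_def h_def)
      qed (simp add: h_def)
    qed
  qed
  finally show ?thesis by (simp add: set_lebesgue_integral_def)
qed

section \<open>Conservation on one time slab\<close>

lemma norm_grad_h: "(norm (grad_h \<T> v x))\<^sup>2 = (\<Sum>j\<in>UNIV. (cmod (pderiv_h \<T> j v x))\<^sup>2)"
  by (simp add: norm_vec_def L2_set_def grad_h_def sum_nonneg)

context box_partition
begin

lemma piecewise_C1_cong:
  assumes "\<And>x. x \<in> cbox a b \<Longrightarrow> v x = w x" and "piecewise_C1 \<T> j w"
  shows "piecewise_C1 \<T> j v"
  unfolding piecewise_C1_def
proof
  fix K assume K: "K \<in> \<T>"
  then obtain p where "C1_along j p" "\<forall>x\<in>K. w x = p x"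
    using assms(2) unfolding piecewise_C1_def by blast
  moreover have "K \<subseteq> cbox a b" using K Union_mesh by blast
  ultimately show "\<exists>p. C1_along j p \<and> (\<forall>x\<in>K. v x = p x)"
    using assms(1) by (metis subsetD)
qed

lemma set_integrable_mult_pderiv_h:
  assumes v: "continuous_on (cbox a b) v" and w: "piecewise_C1 \<T> j w"
  shows "set_integrable lborel (box a b) (\<lambda>x. v x * pderiv_h \<T> j w x)"
proof -
  obtain M where M: "0 \<le> M" "\<And>x. norm (pderiv_h \<T> j w x) \<le> M"
    using pderiv_h_bounded[OF w] by blast
  have V: "integrable lborel (\<lambda>x. indicator (box a b) x *\<^sub>R v x)"
    using set_integrable_continuous_box[OF v] by (simp add: set_integrable_def)
  have "integrable lborel (\<lambda>x. (indicator (box a b) x *\<^sub>R v x) * pderiv_h \<T> j w x)"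
  proof (rule Bochner_Integration.integrable_bound)
    show "integrable lborel (\<lambda>x. (indicator (box a b) x *\<^sub>R v x) * of_real M)"
      using V by (rule integrable_mult_left)
    show "(\<lambda>x. (indicator (box a b) x *\<^sub>R v x) * pderiv_h \<T> j w x) \<in> borel_measurable lborel"
      using V pderiv_h_measurable[OF w] by (intro borel_measurable_times) auto
    show "AE x in lborel. norm ((indicator (box a b) x *\<^sub>R v x) * pderiv_h \<T> j w x)
        \<le> norm ((indicator (box a b) x *\<^sub>R v x) * of_real M)"
      unfolding norm_mult norm_of_real using M by (intro AE_I2 mult_left_mono) auto
  qed
  then show ?thesis by (simp add: set_integrable_def)
qed

lemma set_integrable_pderiv_h_square:
  assumes "piecewise_C1 \<T> j w"
  shows "set_integrable lborel (box a b) (\<lambda>x. (cmod (pderiv_h \<T> j w x))\<^sup>2)"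
proof -
  obtain M where M: "0 \<le> M" "\<And>x. norm (pderiv_h \<T> j w x) \<le> M"
    using pderiv_h_bounded[OF assms] by blast
  note [measurable] = pderiv_h_measurable[OF assms]
  show ?thesis
    by (rule set_integrable_bounded_box[where B = "M\<^sup>2"]) (use M in \<open>auto intro!: power_mono\<close>)
qed

end

text \<open>
  The coefficient functions \<open>\<phi>\<close> expand \<open>u\<close> in powers of time. The expansion holds on the closed box
  and inside the slab only, so \<open>u\<close> may be continued differently on the neighbouring slabs.
\<close>

locale time_slab = box_partition a b \<T> for a b :: "real^'d" and \<T> :: "(real^'d) set set" +
  fixes k :: nat and \<phi> :: "nat \<Rightarrow> real^'d \<Rightarrow> complex"
    and t0 t1 :: real and u :: "real \<Rightarrow> real^'d \<Rightarrow> complex"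
  assumes t0_less_t1: "t0 < t1"
    and continuous_coeff: "\<And>l. l \<le> k \<Longrightarrow> continuous_on (cbox a b) (\<phi> l)"
    and periodic_coeff: "\<And>l. l \<le> k \<Longrightarrow> periodic_on_box a b (\<phi> l)"
    and piecewise_C1_coeff: "\<And>l j. l \<le> k \<Longrightarrow> piecewise_C1 \<T> j (\<phi> l)"
    and u_eq: "\<And>t x. t \<in> {t0..t1} \<Longrightarrow> x \<in> cbox a b \<Longrightarrow> u t x = time_poly k (\<lambda>l. \<phi> l x) t"
begin

lemma ends: "t0 \<in> {t0..t1}" "t1 \<in> {t0..t1}"
  using t0_less_t1 by auto

lemma continuous_u: "t \<in> {t0..t1} \<Longrightarrow> continuous_on (cbox a b) (u t)"
  by (subst continuous_on_cong[OF refl u_eq])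
    (auto simp: time_poly_def intro!: continuous_intros continuous_coeff)

lemma piecewise_C1_u: "t \<in> {t0..t1} \<Longrightarrow> piecewise_C1 \<T> j (u t)"
  by (rule piecewise_C1_cong[OF u_eq])
    (auto simp: time_poly_def intro!: piecewise_C1_sum piecewise_C1_mult piecewise_C1_const
      piecewise_C1_coeff)

lemma dt_u:
  assumes "t \<in> {t0..t1}" "x \<in> cbox a b"
  shows "dt t0 t1 u t x = time_poly_deriv k (\<lambda>l. \<phi> l x) t"
  unfolding dt_def
proof (rule vector_derivative_within_closed_interval[OF t0_less_t1 assms(1)])
  show "((\<lambda>s. u s x) has_vector_derivative time_poly_deriv k (\<lambda>l. \<phi> l x) t) (at t within {t0..t1})"
    using assms u_eq
    by (intro has_vector_derivative_transform[OF _ _ has_vector_derivative_time_poly]) auto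
qed

lemma pderiv_h_u:
  assumes "t \<in> {t0..t1}"
  shows "pderiv_h \<T> j (u t) x = time_poly k (\<lambda>l. pderiv_h \<T> j (\<phi> l) x) t"
proof -
  have "pderiv_h \<T> j (u t) x = pderiv_h \<T> j (\<lambda>y. \<Sum>l\<le>k. of_real (t ^ l) * \<phi> l y) x"
    using u_eq[OF assms] by (intro pderiv_h_cong) (simp add: time_poly_def)
  also have "\<dots> = (\<Sum>l\<le>k. pderiv_h \<T> j (\<lambda>y. of_real (t ^ l) * \<phi> l y) x)"
    by (intro pderiv_h_sum piecewise_C1_mult piecewise_C1_const piecewise_C1_coeff) auto
  also have "\<dots> = time_poly k (\<lambda>l. pderiv_h \<T> j (\<phi> l) x) t"
    unfolding time_poly_def by (intro sum.cong refl pderiv_h_cmult piecewise_C1_coeff) auto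
  finally show ?thesis .
qed

lemma pderiv_h_dt_u:
  assumes "t \<in> {t0..t1}"
  shows "pderiv_h \<T> j (\<lambda>y. dt t0 t1 u t y) x = time_poly_deriv k (\<lambda>l. pderiv_h \<T> j (\<phi> l) x) t"
proof -
  have "pderiv_h \<T> j (\<lambda>y. dt t0 t1 u t y) x =
      pderiv_h \<T> j (\<lambda>y. \<Sum>l\<le>k. of_real (real l * t ^ (l - 1)) * \<phi> l y) x"
    using dt_u[OF assms] by (intro pderiv_h_cong) (simp add: time_poly_deriv_def)
  also have "\<dots> = (\<Sum>l\<le>k. pderiv_h \<T> j (\<lambda>y. of_real (real l * t ^ (l - 1)) * \<phi> l y) x)"
    by (intro pderiv_h_sum piecewise_C1_mult piecewise_C1_const piecewise_C1_coeff) auto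
  also have "\<dots> = time_poly_deriv k (\<lambda>l. pderiv_h \<T> j (\<phi> l) x) t"
    unfolding time_poly_deriv_def by (intro sum.cong refl pderiv_h_cmult piecewise_C1_coeff) auto
  finally show ?thesis .
qed

lemma pderiv_h_cnj_u:
  assumes "t \<in> {t0..t1}"
  shows "pderiv_h \<T> j (\<lambda>y. cnj (u t y)) x = cnj (time_poly k (\<lambda>l. pderiv_h \<T> j (\<phi> l) x) t)"
  using pderiv_h_cnj[OF piecewise_C1_u[OF assms]] pderiv_h_u[OF assms] by simp

lemma set_integrable_potential:
  fixes F :: "real \<Rightarrow> real"
  assumes "continuous_on {0..} F" "t \<in> {t0..t1}"
  shows "set_integrable lborel (box a b) (\<lambda>x. F ((cmod (u t x))\<^sup>2))"
  by (intro set_integrable_continuous_box continuous_on_compose2[OF assms(1)] continuous_intros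
      continuous_u assms(2)) auto

lemma Re_st_integral_potential:
  fixes F f :: "real \<Rightarrow> real"
  assumes F: "\<And>s. 0 \<le> s \<Longrightarrow> (F has_real_derivative f s) (at s within {0..})"
    and g: "st_integrable a b t0 t1 (\<lambda>t x. (\<i> * dt t0 t1 u t x) *
              (\<i> * of_real (f ((cmod (u t x))\<^sup>2)) * cnj (u t x)))" (is "st_integrable a b t0 t1 ?g")
  shows "Re (st_integral a b t0 t1 ?g) =
    ((LINT x:box a b|lborel. F ((cmod (u t0 x))\<^sup>2)) - (LINT x:box a b|lborel. F ((cmod (u t1 x))\<^sup>2))) / 2"
proof -
  have "continuous_on {0..} F"
    using F by (auto intro!: DERIV_continuous_on)
  note int = set_integrable_potential[OF this]
  let ?I = "\<lambda>x. (F ((cmod (u t0 x))\<^sup>2) - F ((cmod (u t1 x))\<^sup>2)) / 2"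
  have "((\<lambda>t. Re (?g t x)) has_integral ?I x) {t0..t1}" if x: "x \<in> box a b" for x
  proof -
    have x: "x \<in> cbox a b" using x box_subset_cbox by blast
    let ?P = "time_poly k (\<lambda>l. \<phi> l x)" and ?P' = "time_poly_deriv k (\<lambda>l. \<phi> l x)"
    have "((\<lambda>t. - (f ((cmod (?P t))\<^sup>2) * Re (?P' t * cnj (?P t)))) has_integral
        - ((F ((cmod (?P t1))\<^sup>2) - F ((cmod (?P t0))\<^sup>2)) / 2)) {t0..t1}"
      using t0_less_t1
      by (intro has_integral_neg has_integral_potential F has_vector_derivative_time_poly) auto
    moreover have "- ((F ((cmod (?P t1))\<^sup>2) - F ((cmod (?P t0))\<^sup>2)) / 2) = ?I x"
      using u_eq[OF ends(1) x] u_eq[OF ends(2) x] by (simp add: field_simps)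
    ultimately have "((\<lambda>t. - (f ((cmod (?P t))\<^sup>2) * Re (?P' t * cnj (?P t)))) has_integral ?I x) {t0..t1}"
      by simp
    then show ?thesis
    proof (rule has_integral_eq[rotated])
      fix t assume t: "t \<in> {t0..t1}"
      show "- (f ((cmod (?P t))\<^sup>2) * Re (?P' t * cnj (?P t))) = Re (?g t x)"
        unfolding dt_u[OF t x] u_eq[OF t x] by (simp add: algebra_simps)
    qed
  qed
  then have "Re (st_integral a b t0 t1 ?g) = (LINT x:box a b|lborel. ?I x)"
    using int ends by (intro Re_st_integral_eq g set_integrable_divide set_integral_diff AE_I2) auto
  also have "\<dots> = ((LINT x:box a b|lborel. F ((cmod (u t0 x))\<^sup>2)) -
      (LINT x:box a b|lborel. F ((cmod (u t1 x))\<^sup>2))) / 2"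
    using set_integral_diff(2)[OF int[OF ends(1)] int[OF ends(2)]] by simp
  finally show ?thesis .
qed

lemma set_integrable_gradient_square:
  assumes "t \<in> {t0..t1}"
  shows "set_integrable lborel (box a b) (\<lambda>x. (norm (grad_h \<T> (u t) x))\<^sup>2)"
  unfolding norm_grad_h set_integrable_def scaleR_sum_right
  using set_integrable_pderiv_h_square[OF piecewise_C1_u[OF assms]]
  by (intro Bochner_Integration.integrable_sum) (simp add: set_integrable_def)

lemma Re_st_integral_gradient:
  assumes g: "st_integrable a b t0 t1 (\<lambda>t x. bdot (\<i> *s grad_h \<T> (\<lambda>y. dt t0 t1 u t y) x)
                            (\<i> *s grad_h \<T> (\<lambda>y. cnj (u t y)) x))" (is "st_integrable a b t0 t1 ?g")
  shows "Re (st_integral a b t0 t1 ?g) =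
    ((LINT x:box a b|lborel. (norm (grad_h \<T> (u t0) x))\<^sup>2) -
     (LINT x:box a b|lborel. (norm (grad_h \<T> (u t1) x))\<^sup>2)) / 2"
proof -
  note int = set_integrable_gradient_square
  let ?I = "\<lambda>x. ((norm (grad_h \<T> (u t0) x))\<^sup>2 - (norm (grad_h \<T> (u t1) x))\<^sup>2) / 2"
  have "((\<lambda>t. Re (?g t x)) has_integral ?I x) {t0..t1}" for x
  proof -
    let ?P = "\<lambda>j. time_poly k (\<lambda>l. pderiv_h \<T> j (\<phi> l) x)"
      and ?P' = "\<lambda>j. time_poly_deriv k (\<lambda>l. pderiv_h \<T> j (\<phi> l) x)"
    have "((\<lambda>t. \<Sum>j\<in>UNIV. - (1 * Re (?P' j t * cnj (?P j t)))) has_integral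
        (\<Sum>j\<in>UNIV. - (((cmod (?P j t1))\<^sup>2 - (cmod (?P j t0))\<^sup>2) / 2))) {t0..t1}"
      using t0_less_t1
      by (intro has_integral_sum has_integral_neg
          has_integral_potential[where F = "\<lambda>s. s" and f = "\<lambda>s. 1"] has_vector_derivative_time_poly)
        auto
    moreover have "(\<Sum>j\<in>UNIV. - (((cmod (?P j t1))\<^sup>2 - (cmod (?P j t0))\<^sup>2) / 2)) = ?I x"
      unfolding norm_grad_h pderiv_h_u[OF ends(1)] pderiv_h_u[OF ends(2)]
      by (simp add: sum_negf sum_subtractf diff_divide_distrib flip: sum_divide_distrib)
    ultimately have "((\<lambda>t. \<Sum>j\<in>UNIV. - (1 * Re (?P' j t * cnj (?P j t)))) has_integral ?I x) {t0..t1}"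
      by simp
    then show ?thesis
    proof (rule has_integral_eq[rotated])
      fix t assume t: "t \<in> {t0..t1}"
      show "(\<Sum>j\<in>UNIV. - (1 * Re (?P' j t * cnj (?P j t)))) = Re (?g t x)"
        unfolding bdot_def grad_h_def vector_smult_component vec_lambda_beta pderiv_h_dt_u[OF t]
          pderiv_h_cnj_u[OF t] Re_sum
        by (intro sum.cong) (auto simp: algebra_simps)
    qed
  qed
  then have "Re (st_integral a b t0 t1 ?g) = (LINT x:box a b|lborel. ?I x)"
    using int ends by (intro Re_st_integral_eq g set_integrable_divide set_integral_diff AE_I2) auto
  also have "\<dots> = ((LINT x:box a b|lborel. (norm (grad_h \<T> (u t0) x))\<^sup>2) -
     (LINT x:box a b|lborel. (norm (grad_h \<T> (u t1) x))\<^sup>2)) / 2"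
    using set_integral_diff(2)[OF int[OF ends(1)] int[OF ends(2)]] by simp
  finally show ?thesis .
qed

lemma mass_conservation:
  assumes "eq_mass a b t0 t1 u"
  shows "mass a b (u t1) = mass a b (u t0)"
  using assms Re_st_integral_potential[of "\<lambda>s. s" "\<lambda>s. 1"]
  by (simp add: eq_mass_def mass_def Let_def)

lemma energy_conservation:
  fixes F f :: "real \<Rightarrow> real"
  assumes F: "\<And>s. 0 \<le> s \<Longrightarrow> (F has_real_derivative f s) (at s within {0..})"
    and "eq_energy a b \<T> f t0 t1 u"
  shows "energy a b \<T> F (u t1) = energy a b \<T> F (u t0)"
proof -
  have "continuous_on {0..} F"
    using F by (auto intro!: DERIV_continuous_on)
  note intF = set_integrable_potential[OF this]
  let ?G = "\<lambda>t. LINT x:box a b|lborel. (norm (grad_h \<T> (u t) x))\<^sup>2"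
    and ?V = "\<lambda>t. LINT x:box a b|lborel. F ((cmod (u t x))\<^sup>2)"
  have energy: "energy a b \<T> F (u t) = (?G t - ?V t) / 2" if "t \<in> {t0..t1}" for t
    using set_integral_diff(2)[OF set_integrable_gradient_square intF, OF that that]
    by (simp add: energy_def)
  let ?g1 = "\<lambda>t x. bdot (\<i> *s grad_h \<T> (\<lambda>y. dt t0 t1 u t y) x)
      (\<i> *s grad_h \<T> (\<lambda>y. cnj (u t y)) x)"
    and ?g2 = "\<lambda>t x. (\<i> * dt t0 t1 u t x) * (\<i> * of_real (f ((cmod (u t x))\<^sup>2)) * cnj (u t x))"
  have g: "st_integrable a b t0 t1 ?g1" "st_integrable a b t0 t1 ?g2"
    "Re (st_integral a b t0 t1 ?g1) - Re (st_integral a b t0 t1 ?g2) = 0"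
    using assms(2) unfolding eq_energy_def Let_def by blast+
  then have "(?G t0 - ?G t1) / 2 - (?V t0 - ?V t1) / 2 = 0"
    using Re_st_integral_gradient[OF g(1)] Re_st_integral_potential[OF F g(2)] by simp
  then show ?thesis
    using energy[OF ends(1)] energy[OF ends(2)] by argo
qed

text \<open>
  This is the integral of $\bar u\,\partial_tu$ over the slab in time. Written as a finite sum of products of
  coefficient functions, it can be differentiated in space term by term, which avoids
  differentiation under the integral sign.
\<close>

definition time_integrated_product :: "real^'d \<Rightarrow> complex" where
  "time_integrated_product x = (\<Sum>i\<le>k. \<Sum>l\<le>k. time_weight t0 t1 i l * (cnj (\<phi> i x) * \<phi> l x))"

lemma continuous_time_integrated_product: "continuous_on (cbox a b) time_integrated_product"
  unfolding time_integrated_product_def[abs_def]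
  by (intro continuous_intros continuous_coeff) auto

lemma periodic_time_integrated_product: "periodic_on_box a b time_integrated_product"
  using periodic_coeff unfolding periodic_on_box_def time_integrated_product_def
  by (auto intro!: sum.cong)

lemma piecewise_C1_time_integrated_product: "piecewise_C1 \<T> j time_integrated_product"
  unfolding time_integrated_product_def[abs_def]
  by (intro piecewise_C1_sum piecewise_C1_mult piecewise_C1_cnj piecewise_C1_const
      piecewise_C1_coeff) auto

lemma pderiv_h_time_integrated_product:
  "pderiv_h \<T> j time_integrated_product x =
     (\<Sum>i\<le>k. \<Sum>l\<le>k. time_weight t0 t1 i l *
        (cnj (\<phi> i x) * pderiv_h \<T> j (\<phi> l) x + cnj (pderiv_h \<T> j (\<phi> i) x) * \<phi> l x))"
proof -
  let ?g = "\<lambda>i l y. time_weight t0 t1 i l * (cnj (\<phi> i y) * \<phi> l y)"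
  have g: "piecewise_C1 \<T> j (?g i l)" if "i \<le> k" "l \<le> k" for i l
    using that by (intro piecewise_C1_mult piecewise_C1_cnj piecewise_C1_const piecewise_C1_coeff)
  have "pderiv_h \<T> j time_integrated_product x = (\<Sum>i\<le>k. pderiv_h \<T> j (\<lambda>y. \<Sum>l\<le>k. ?g i l y) x)"
    unfolding time_integrated_product_def[abs_def]
    by (intro pderiv_h_sum piecewise_C1_sum g) auto
  also have "\<dots> = (\<Sum>i\<le>k. \<Sum>l\<le>k. pderiv_h \<T> j (?g i l) x)"
    by (intro sum.cong refl pderiv_h_sum g) auto
  also have "\<dots> = (\<Sum>i\<le>k. \<Sum>l\<le>k. time_weight t0 t1 i l *
        (cnj (\<phi> i x) * pderiv_h \<T> j (\<phi> l) x + cnj (pderiv_h \<T> j (\<phi> i) x) * \<phi> l x))"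
    using piecewise_C1_coeff
    by (intro sum.cong refl)
      (simp add: pderiv_h_cmult pderiv_h_mult pderiv_h_cnj piecewise_C1_mult piecewise_C1_cnj)
  finally show ?thesis .
qed

text \<open>
  Pointwise in \<open>x\<close>, twice the time integral of \<open>Re (\<i> * \<partial>\<^sub>t u * cnj (\<partial>\<^sub>j u))\<close> is the
  increment of \<open>Im (cnj u * \<partial>\<^sub>j u)\<close> minus the imaginary part of the spatial derivative of
  \<open>time_integrated_product\<close>. The latter has integral \<open>0\<close> over the box by periodicity.
\<close>

lemma momentum_conservation:
  assumes "eq_momentum a b \<T> t0 t1 u"
  shows "momentum a b \<T> (u t1) = momentum a b \<T> (u t0)"
proof -
  have "Im (LINT x:box a b|lborel. cnj (u t1 x) * pderiv_h \<T> j (u t1) x) =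
      Im (LINT x:box a b|lborel. cnj (u t0 x) * pderiv_h \<T> j (u t0) x)" for j
  proof -
    let ?g = "\<lambda>t x. (\<i> * dt t0 t1 u t x) * pderiv_h \<T> j (\<lambda>y. cnj (u t y)) x"
    let ?p = "\<lambda>t x. cnj (u t x) * pderiv_h \<T> j (u t) x"
    \<comment> \<open>The factor 1 makes the integrand an instance of \<open>set_integrable_mult_pderiv_h\<close>.\<close>
    let ?q = "\<lambda>x. 1 * pderiv_h \<T> j time_integrated_product x"
    let ?J = "\<lambda>x. ?p t1 x - ?p t0 x - ?q x"
    have g: "st_integrable a b t0 t1 ?g" "Re (st_integral a b t0 t1 ?g) = 0"
      using assms by (auto simp: eq_momentum_def Let_def)
    have p: "set_integrable lborel (box a b) (?p t)" if "t \<in> {t0..t1}" for t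
      using that
      by (intro set_integrable_mult_pderiv_h continuous_intros continuous_u piecewise_C1_u)
    have q: "set_integrable lborel (box a b) ?q"
      by (intro set_integrable_mult_pderiv_h continuous_intros piecewise_C1_time_integrated_product)
    have J: "set_integrable lborel (box a b) ?J"
      by (intro set_integral_diff p q ends)
    have has_int: "((\<lambda>t. Re (?g t x)) has_integral Im (?J x) / 2) {t0..t1}"
      if x: "x \<in> box a b" for x
    proof -
      have x: "x \<in> cbox a b" using x box_subset_cbox by blast
      let ?c = "\<lambda>l. \<phi> l x" and ?d = "\<lambda>l. pderiv_h \<T> j (\<phi> l) x"
      have "((\<lambda>t. Re (\<i> * time_poly_deriv k ?c t * cnj (time_poly k ?d t))) has_integral Im (?J x) / 2)
          {t0..t1}"
        using has_integral_momentum[OF less_imp_le[OF t0_less_t1], of k ?c ?d]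
          u_eq[OF ends(1) x] u_eq[OF ends(2) x] pderiv_h_u[OF ends(1)] pderiv_h_u[OF ends(2)]
        by (simp only: pderiv_h_time_integrated_product minus_complex.simps mult_1)
      then show ?thesis
        by (rule has_integral_eq[rotated]) (simp add: dt_u[OF _ x] pderiv_h_cnj_u)
    qed
    have Im_J: "set_integrable lborel (box a b) (\<lambda>x. Im (?J x))"
      "(LINT x:box a b|lborel. Im (?J x)) = Im (LINT x:box a b|lborel. ?J x)"
      using integrable_Im[OF J[unfolded set_integrable_def]]
        integral_Im[OF J[unfolded set_integrable_def]]
      by (simp_all add: set_integrable_def set_lebesgue_integral_def)
    have "Re (st_integral a b t0 t1 ?g) = (LINT x:box a b|lborel. Im (?J x) / 2)"
      using has_int by (intro Re_st_integral_eq g set_integrable_divide Im_J AE_I2 impI)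
    also have "\<dots> = Im (LINT x:box a b|lborel. ?J x) / 2"
      by (simp only: set_integral_divide_zero Im_J)
    also have "(LINT x:box a b|lborel. ?J x) = (LINT x:box a b|lborel. ?p t1 x) -
        (LINT x:box a b|lborel. ?p t0 x) - (LINT x:box a b|lborel. ?q x)"
      using p[OF ends(1)] p[OF ends(2)] q by (simp only: set_integral_diff)
    also have "(LINT x:box a b|lborel. ?q x) = 0"
      using integral_pderiv_h_eq_0[OF continuous_time_integrated_product
          periodic_time_integrated_product piecewise_C1_time_integrated_product] by simp
    finally show ?thesis
      using g(2) by simp
  qed
  then show ?thesis by (simp add: momentum_def)
qed

end

section \<open>The scheme\<close>

lemma regular_mesh_imp_box_partition:
  fixes a b :: "real^'d"
  assumes "\<And>j. a $ j < b $ j" "regular_mesh a b h \<sigma> \<gamma> \<T>"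
  shows "box_partition a b \<T>"
proof
  have simplex: "int CARD('d) simplex K" if "K \<in> \<T>" for K
    using assms(2) that by (simp add: regular_mesh_def)
  show "finite \<T>" "\<Union>\<T> = cbox a b"
    using assms(2) by (auto simp: regular_mesh_def triangulation_def)
  show "closed K" if "K \<in> \<T>" for K
    using simplex[OF that] by (rule closed_simplex)
  show "negligible (frontier K)" if "K \<in> \<T>" for K
    using simplex[OF that]
    by (auto simp: simplex_def intro!: negligible_convex_frontier)
qed (use assms in auto)

lemma scheme_step_imp_time_slab:
  assumes "box_partition a b \<T>" "t0 < t1" "scheme_step a b \<T> r k f t0 t1 U u \<kappa>0 \<kappa>1 \<kappa>"
  obtains \<phi> where "time_slab a b \<T> k \<phi> t0 t1 u"
proof -
  obtain \<phi> where \<phi>: "\<And>l. l \<le> k \<Longrightarrow> \<phi> l \<in> fe_space a b \<T> r"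
    "\<And>t x. t \<in> {t0..t1} \<Longrightarrow> x \<in> cbox a b \<Longrightarrow> u t x = (\<Sum>l\<le>k. of_real (t ^ l) * \<phi> l x)"
    using assms(3) unfolding scheme_step_def poly_tensor_def by fastforce
  interpret box_partition a b \<T> by fact
  have "time_slab a b \<T> k \<phi> t0 t1 u"
  proof
    show "continuous_on (cbox a b) (\<phi> l)" "periodic_on_box a b (\<phi> l)" if "l \<le> k" for l
      using \<phi>(1)[OF that] by (auto simp: fe_space_def)
    show "piecewise_C1 \<T> j (\<phi> l)" if "l \<le> k" for l j
      using \<phi>(1)[OF that] by (auto simp: fe_space_def intro: is_poly_imp_piecewise_C1)
    show "u t x = time_poly k (\<lambda>l. \<phi> l x) t" if "t \<in> {t0..t1}" "x \<in> cbox a b" for t x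
      using \<phi>(2)[OF that] by (simp add: time_poly_def)
  qed fact
  then show ?thesis by (rule that)
qed

theorem theorem2p1:
  fixes a b :: "real^'d" and \<T> :: "(real^'d) set set"
    and h \<sigma> \<gamma> T :: real and r k N :: nat
    and F f :: "real \<Rightarrow> real"
    and uh :: "nat \<Rightarrow> real^'d \<Rightarrow> complex"
    and u :: "real \<Rightarrow> real^'d \<Rightarrow> complex"
    and \<kappa>0 \<kappa>1 :: "nat \<Rightarrow> real" and \<kappa> :: "nat \<Rightarrow> real^'d"
  assumes "\<And>j. a $ j < b $ j"
    and "\<And>s. 0 \<le> s \<Longrightarrow> (F has_real_derivative f s) (at s within {0..})"
    and "0 < h" and "h \<le> 1" and "regular_mesh a b h \<sigma> \<gamma> \<T>"
    and "1 \<le> r" and "1 \<le> k" and "0 < T" and "1 \<le> N"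
    and "scheme_solution a b \<T> r k f T N uh u \<kappa>0 \<kappa>1 \<kappa>"
  shows "\<forall>n\<in>{1..N}.
           mass a b (u (tnode T N n)) = mass a b (u (tnode T N (n - 1))) \<and>
           momentum a b \<T> (u (tnode T N n)) = momentum a b \<T> (u (tnode T N (n - 1))) \<and>
           energy a b \<T> F (u (tnode T N n)) = energy a b \<T> F (u (tnode T N (n - 1)))"
proof
  fix n assume n: "n \<in> {1..N}"
  define t0 t1 where "t0 = tnode T N (n - 1)" and "t1 = tnode T N n"
  have "t0 < t1"
    using n assms(8,9) by (auto simp: t0_def t1_def tnode_def intro!: divide_strict_right_mono)
  have step: "scheme_step a b \<T> r k f t0 t1 (uh (n - 1)) u (\<kappa>0 n) (\<kappa>1 n) (\<kappa> n)"
    using assms(10) n by (simp add: scheme_solution_def t0_def t1_def)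
  have "box_partition a b \<T>"
    using assms(1,5) by (rule regular_mesh_imp_box_partition)
  then obtain \<phi> where "time_slab a b \<T> k \<phi> t0 t1 u"
    using \<open>t0 < t1\<close> step by (rule scheme_step_imp_time_slab)
  then interpret time_slab a b \<T> k \<phi> t0 t1 u .
  have "eq_mass a b t0 t1 u" "eq_energy a b \<T> f t0 t1 u" "eq_momentum a b \<T> t0 t1 u"
    using step by (auto simp: scheme_step_def)
  then show "mass a b (u (tnode T N n)) = mass a b (u (tnode T N (n - 1))) \<and>
      momentum a b \<T> (u (tnode T N n)) = momentum a b \<T> (u (tnode T N (n - 1))) \<and>
      energy a b \<T> F (u (tnode T N n)) = energy a b \<T> F (u (tnode T N (n - 1)))"
    unfolding t0_def[symmetric] t1_def[symmetric]
    using mass_conservation momentum_conservation energy_conservation[OF assms(2)] by blast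
qed

end
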